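(* Let $K$ be a subfield of $\mathbb{R}$, let $\mathbb{R}_K=\big(\mathbb{R},<,+,(\lambda_k)_{k\in K}\big)$ where $\lambda_k:\mathbb{R}\to\mathbb{R}$ is $x\mapsto kx$, and let $(\mathbb{R}_K,\mathbb{Q})$ be the expansion of $\mathbb{R}_K$ by a unary predicate for $\mathbb{Q}$. Then every subset of $\mathbb{R}^n$ definable (with parameters) in $(\mathbb{R}_K,\mathbb{Q})$ is a Boolean combination of sets of the form \[ \bigcup_{\vec q\in\mathbb{Q}^m}\big\{\vec a\in\mathbb{R}^n : (\vec q,\vec a)\in X\big\}, \] where $m\in\mathbb{N}$ and $X\subseteq\mathbb{R}^{m+n}$ is definable (with parameters) in $\mathbb{R}_K$. Furthermore, every open subset of $\mathbb{R}^n$ definable in $(\mathbb{R}_K,\mathbb{Q})$ is already definable in $\mathbb{R}_K$. *)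

theory Defs
  imports "HOL-Analysis.Analysis" "HOL-Algebra.Algebraic_Closure_Type"
begin

text \<open>
  Points of \<open>\<real>\<^sup>n\<close> are the points of \<^const>\<open>Euclidean_space\<close>, i.e. sequences vanishing from
  index \<open>n\<close> on, so that the dimension can be quantified over inside a formula.
\<close>

abbreviation Rn :: "nat \<Rightarrow> (nat \<Rightarrow> real) set" where
  "Rn n \<equiv> topspace (Euclidean_space n)"

definition Qn :: "nat \<Rightarrow> (nat \<Rightarrow> real) set" where
  "Qn m = {q \<in> Rn m. \<forall>i<m. q i \<in> \<rat>}"

definition tuple_append :: "nat \<Rightarrow> (nat \<Rightarrow> real) \<Rightarrow> (nat \<Rightarrow> real) \<Rightarrow> nat \<Rightarrow> real" where
  "tuple_append m q a = (\<lambda>i. if i < m then q i else a (i - m))"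

text \<open>
  First-order formulas, with de Bruijn indices, in the language \<open><, +, (\<lambda>\<^sub>k)\<^sub>k\<close> extended by a unary
  predicate. The constants \<open>Param c\<close> name the parameters; \<open>Lam k\<close> is the symbol \<open>\<lambda>\<^sub>k\<close>.
\<close>

datatype tm =
    Var nat
  | Param real
  | Plus tm tm
  | Lam real tm

datatype fm =
    FEq tm tm
  | FLess tm tm
  | FPred tm
  | FNeg fm
  | FConj fm fm
  | FEx fm

primrec tm_val :: "(nat \<Rightarrow> real) \<Rightarrow> tm \<Rightarrow> real" where
  "tm_val e (Var i) = e i"
| "tm_val e (Param c) = c"
| "tm_val e (Plus s t) = tm_val e s + tm_val e t"
| "tm_val e (Lam k t) = k * tm_val e t"

primrec sat :: "real set \<Rightarrow> (nat \<Rightarrow> real) \<Rightarrow> fm \<Rightarrow> bool" where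
  "sat P e (FEq s t) \<longleftrightarrow> tm_val e s = tm_val e t"
| "sat P e (FLess s t) \<longleftrightarrow> tm_val e s < tm_val e t"
| "sat P e (FPred t) \<longleftrightarrow> tm_val e t \<in> P"
| "sat P e (FNeg f) \<longleftrightarrow> \<not> sat P e f"
| "sat P e (FConj f g) \<longleftrightarrow> sat P e f \<and> sat P e g"
| "sat P e (FEx f) \<longleftrightarrow> (\<exists>x. sat P (case_nat x e) f)"

text \<open>
  \<open>is_tm K n\<close> and \<open>is_fm K n\<close>: the free variables are among the first \<open>n\<close>, and only symbols
  \<open>\<lambda>\<^sub>k\<close> with \<open>k \<in> K\<close> occur.
\<close>

primrec is_tm :: "real set \<Rightarrow> nat \<Rightarrow> tm \<Rightarrow> bool" where
  "is_tm K n (Var i) \<longleftrightarrow> i < n"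
| "is_tm K n (Param c) \<longleftrightarrow> True"
| "is_tm K n (Plus s t) \<longleftrightarrow> is_tm K n s \<and> is_tm K n t"
| "is_tm K n (Lam k t) \<longleftrightarrow> k \<in> K \<and> is_tm K n t"

primrec is_fm :: "real set \<Rightarrow> nat \<Rightarrow> fm \<Rightarrow> bool" where
  "is_fm K n (FEq s t) \<longleftrightarrow> is_tm K n s \<and> is_tm K n t"
| "is_fm K n (FLess s t) \<longleftrightarrow> is_tm K n s \<and> is_tm K n t"
| "is_fm K n (FPred t) \<longleftrightarrow> is_tm K n t"
| "is_fm K n (FNeg f) \<longleftrightarrow> is_fm K n f"
| "is_fm K n (FConj f g) \<longleftrightarrow> is_fm K n f \<and> is_fm K n g"
| "is_fm K n (FEx f) \<longleftrightarrow> is_fm K (Suc n) f"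

primrec pred_free :: "fm \<Rightarrow> bool" where
  "pred_free (FEq s t) \<longleftrightarrow> True"
| "pred_free (FLess s t) \<longleftrightarrow> True"
| "pred_free (FPred t) \<longleftrightarrow> False"
| "pred_free (FNeg f) \<longleftrightarrow> pred_free f"
| "pred_free (FConj f g) \<longleftrightarrow> pred_free f \<and> pred_free g"
| "pred_free (FEx f) \<longleftrightarrow> pred_free f"

text \<open>Definability, with parameters, of \<open>S \<subseteq> \<real>\<^sup>n\<close> in \<open>(\<real>\<^sub>K, P)\<close>.\<close>

definition definable_pair :: "real set \<Rightarrow> real set \<Rightarrow> nat \<Rightarrow> (nat \<Rightarrow> real) set \<Rightarrow> bool" where
  "definable_pair K P n S \<longleftrightarrow> (\<exists>f. is_fm K n f \<and> S = {x \<in> Rn n. sat P x f})"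

text \<open>
  Definability, with parameters, of \<open>S \<subseteq> \<real>\<^sup>n\<close> in \<open>\<real>\<^sub>K\<close>. The interpretation of the predicate is
  immaterial for formulas that do not contain it; the empty set is an arbitrary choice.
\<close>

definition definable_RK :: "real set \<Rightarrow> nat \<Rightarrow> (nat \<Rightarrow> real) set \<Rightarrow> bool" where
  "definable_RK K n S \<longleftrightarrow> (\<exists>f. is_fm K n f \<and> pred_free f \<and> S = {x \<in> Rn n. sat {} x f})"

lemma sat_pred_free: "pred_free f \<Longrightarrow> sat P e f \<longleftrightarrow> sat P' e f"
  by (induction f arbitrary: e) auto

inductive_set boolean_combinations :: "'a set \<Rightarrow> 'a set set \<Rightarrow> 'a set set"
  for \<Omega> :: "'a set" and G :: "'a set set" where
  base: "A \<in> G \<Longrightarrow> A \<in> boolean_combinations \<Omega> G"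
| compl: "A \<in> boolean_combinations \<Omega> G \<Longrightarrow> \<Omega> - A \<in> boolean_combinations \<Omega> G"
| union: "A \<in> boolean_combinations \<Omega> G \<Longrightarrow> B \<in> boolean_combinations \<Omega> G
    \<Longrightarrow> A \<union> B \<in> boolean_combinations \<Omega> G"
| inter: "A \<in> boolean_combinations \<Omega> G \<Longrightarrow> B \<in> boolean_combinations \<Omega> G
    \<Longrightarrow> A \<inter> B \<in> boolean_combinations \<Omega> G"

end

theory Submission
  imports Defs
begin

text \<open>
  A formula of \<open>(\<real>\<^sub>K, \<rat>)\<close> is treated as a predicate on environments, and quantifiers are eliminated
  among predicates "there are rational \<open>q\<close> satisfying finitely many affine equations and strict
  inequalities in \<open>(q, a)\<close>". The rational solutions of affine equations over \<open>K\<close> form a coset of a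
  rational subspace. Moving along this subspace, in which rational points are dense, turns
  superfluous rational quantifiers into real ones, which Fourier-Motzkin elimination removes. One may
  therefore assume that \<open>q\<close> is determined by \<open>a\<close> and the equations, so that a negation amounts to
  the negation of a purely equational condition. Along a rational line such a condition is either
  invariant or holds at most once, and along a real line it is either invariant or holds countably
  often. Hence it can be avoided in a nonempty open set unless it is invariant, and invariant
  conditions move out of the scope of the quantifier.

  For the statement on open sets it suffices that the closure of a definable set is definable in
  \<open>\<real>\<^sub>K\<close>. Equations that constrain a real variable are solved for it; an equation in rational
  variables alone is solved over \<open>\<rat>\<close> by applying a \<open>\<rat>\<close>-linear retraction \<open>\<real> \<rightarrow> \<rat>\<close>. What
  remains is an open condition from which finitely many generically false equational conditions are
  removed, and its closure does not change if the rational variables are made real.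
\<close>

section \<open>Affine forms over a subfield of the reals\<close>

lemma ex_small_rational_avoiding:
  fixes T :: "'a \<Rightarrow> real \<Rightarrow> bool"
  assumes "finite A" "0 < d"
    and once: "\<And>a s t. \<lbrakk>a \<in> A; s \<in> \<rat>; t \<in> \<rat>; T a s; T a t\<rbrakk> \<Longrightarrow> s = t"
  shows "\<exists>t\<in>\<rat>. 0 < t \<and> t < d \<and> (\<forall>a\<in>A. \<not> T a t)"
proof -
  have "finite {t \<in> \<rat>. T a t}" if "a \<in> A" for a
  proof (cases "\<exists>s\<in>\<rat>. T a s")
    case True
    then obtain s where "s \<in> \<rat>" "T a s" by blast
    then have "{t \<in> \<rat>. T a t} \<subseteq> {s}" using once[OF that] by blast
    then show ?thesis by (rule finite_subset) simp
  next
    case False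
    then have "{t \<in> \<rat>. T a t} = {}" by blast
    then show ?thesis by (metis finite.emptyI)
  qed
  \<comment> \<open>Only finitely many rationals are excluded, at most one per condition, while the
    numbers \<open>r / (n + 1)\<close> supply infinitely many candidates in (0, d).\<close>
  then have fin: "finite (\<Union>a\<in>A. {t \<in> \<rat>. T a t})" using \<open>finite A\<close> by blast
  obtain r where r: "r \<in> \<rat>" "0 < r" "r < d" using Rats_dense_in_real[OF \<open>0 < d\<close>] by blast
  have "inj (\<lambda>n::nat. r / real (Suc n))" using r(2) by (intro injI) (simp add: field_simps)
  then have "infinite (range (\<lambda>n::nat. r / real (Suc n)))" by (rule range_inj_infinite)
  then obtain t where t: "t \<in> range (\<lambda>n::nat. r / real (Suc n))" "t \<notin> (\<Union>a\<in>A. {t \<in> \<rat>. T a t})"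
    using fin finite_subset[of "range (\<lambda>n::nat. r / real (Suc n))"] by blast
  then obtain n :: nat where n: "t = r / real (Suc n)" by blast
  have "t \<le> r" unfolding n using r(2) by (simp add: divide_le_eq)
  moreover have "t \<in> \<rat>" "0 < t" using r n by (auto intro!: Rats_divide simp del: of_nat_Suc)
  ultimately show ?thesis using t(2) r(3) by (intro bexI[of _ t]) auto
qed

text \<open>The number 1 belongs to a basis of the reals over \<rat>, which yields a \<rat>-linear
  retraction onto \<rat>. Applied to an equation in rational unknowns, it replaces real coefficients
  by rational ones.\<close>

lemma ex_rational_functional:
  obtains f :: "real \<Rightarrow> real"
  where "\<And>x y. f (x + y) = f x + f y" "\<And>q x. q \<in> \<rat> \<Longrightarrow> f (q * x) = q * f x"
    "\<And>x. f x \<in> \<rat>" "\<And>q. q \<in> \<rat> \<Longrightarrow> f q = q"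
proof -
  interpret vp: vector_space_pair "\<lambda>(q::rat) (x::real). of_rat q * x" "\<lambda>(q::rat) (x::rat). q * x"
    by unfold_locales (auto simp: algebra_simps of_rat_add of_rat_mult)
  have "vp.vs1.independent {1::real}" by simp
  from vp.linear_independent_extend[OF this, of "\<lambda>_. 1"] obtain g :: "real \<Rightarrow> rat" where
    g: "Vector_Spaces.linear (\<lambda>(q::rat) (x::real). of_rat q * x) (\<lambda>(q::rat) (x::rat). q * x) g" "g 1 = 1"
    by auto
  interpret g: Vector_Spaces.linear "\<lambda>(q::rat) (x::real). of_rat q * x" "\<lambda>(q::rat) (x::rat). q * x" g
    by (rule g(1))
  have sc: "(of_rat (g (q * x)) :: real) = q * of_rat (g x)" if "q \<in> \<rat>" for q x :: real
    using that by (auto elim!: Rats_cases simp: g.scale of_rat_mult)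
  show thesis
  proof (rule that[of "\<lambda>x. of_rat (g x)"])
    show "(of_rat (g q) :: real) = q" if "q \<in> \<rat>" for q using sc[OF that, of 1] g(2) by simp
  qed (auto simp: g.add of_rat_add sc)
qed

lemma ex_between_finite:
  fixes L U :: "real set"
  assumes "finite L" "finite U" "\<And>a b. a \<in> L \<Longrightarrow> b \<in> U \<Longrightarrow> a < b"
  shows "\<exists>x. (\<forall>a\<in>L. a < x) \<and> (\<forall>b\<in>U. x < b)"
proof (cases "L = {} \<or> U = {}")
  case True
  then show ?thesis
  proof
    assume "L = {}"
    \<comment> \<open>Inserting 0 makes the minimum meaningful even if \<open>U\<close> is empty
      too.\<close>
    have "\<forall>b\<in>U. Min (insert 0 U) - 1 < b" using assms(2)
      by (meson Min_le finite_insert insertCI less_add_one less_le_trans diff_less_eq)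
    then show ?thesis using \<open>L = {}\<close> by blast
  next
    assume "U = {}"
    have "\<forall>a\<in>L. a < Max (insert 0 L) + 1" using assms(1)
      by (meson Max_ge finite_insert insertCI less_add_one le_less_trans)
    then show ?thesis using \<open>U = {}\<close> by blast
  qed
next
  case False
  then have "Max L < Min U" using assms by (simp add: assms(3))
  then obtain x where "Max L < x" "x < Min U" using dense by blast
  then show ?thesis using assms(1,2)
    by (intro exI[of _ x]) (meson Max_ge Min_le le_less_trans less_le_trans)
qed

lemma ball_sign_split:
  fixes k :: "'a \<Rightarrow> real"
  shows "(\<forall>h\<in>G. if k h > 0 then P h else if k h < 0 then Q h else R h) \<longleftrightarrow>
    (\<forall>h\<in>{h \<in> G. k h = 0}. R h) \<and> (\<forall>h\<in>{h \<in> G. k h > 0}. P h) \<and> (\<forall>h\<in>{h \<in> G. k h < 0}. Q h)"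
  by (smt (verit) mem_Collect_eq)

text \<open>These are the candidate witnesses for a block of rational quantifiers at
  \<open>e\<close>. Their countability bounds how often a non-invariant equational condition can
  hold along a real line.\<close>

lemma countable_rational_modifications:
  fixes e :: "nat \<Rightarrow> real"
  assumes "finite J"
  shows "countable {e'. (\<forall>i. i \<notin> J \<longrightarrow> e' i = e i) \<and> (\<forall>i\<in>J. e' i \<in> \<rat>)}"
proof -
  have "countable (\<rat> :: real set)" by (rule countable_rat)
  then have "countable (Pi\<^sub>E J (\<lambda>_. \<rat> :: real set))" using assms by (intro countable_PiE) auto
  then have "countable ((\<lambda>q i. if i \<in> J then q i else e i) ` Pi\<^sub>E J (\<lambda>_. \<rat> :: real set))" by simp
  moreover have "{e'. (\<forall>i. i \<notin> J \<longrightarrow> e' i = e i) \<and> (\<forall>i\<in>J. e' i \<in> \<rat>)} \<subseteq>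
    (\<lambda>q i. if i \<in> J then q i else e i) ` Pi\<^sub>E J (\<lambda>_. \<rat>)"
  proof
    fix e' assume e': "e' \<in> {e'. (\<forall>i. i \<notin> J \<longrightarrow> e' i = e i) \<and> (\<forall>i\<in>J. e' i \<in> \<rat>)}"
    then have "e' = (\<lambda>i. if i \<in> J then restrict e' J i else e i)" by auto
    moreover have "restrict e' J \<in> Pi\<^sub>E J (\<lambda>_. \<rat>)" using e' by auto
    ultimately show "e' \<in> (\<lambda>q i. if i \<in> J then q i else e i) ` Pi\<^sub>E J (\<lambda>_. \<rat>)" by (rule image_eqI)
  qed
  ultimately show ?thesis by (rule countable_subset[rotated])
qed

text \<open>Closure is expressed in the arithmetic of the type \<open>real\<close>. The rule for
  inverses can include 0 because \<open>inverse 0 = 0\<close> in HOL.\<close>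

locale real_subfield =
  fixes K :: "real set"
  assumes K_add: "\<And>a b. a \<in> K \<Longrightarrow> b \<in> K \<Longrightarrow> a + b \<in> K"
    and K_mult: "\<And>a b. a \<in> K \<Longrightarrow> b \<in> K \<Longrightarrow> a * b \<in> K"
    and K_uminus: "\<And>a. a \<in> K \<Longrightarrow> - a \<in> K"
    and K_inverse: "\<And>a. a \<in> K \<Longrightarrow> inverse a \<in> K"
    and K_one: "1 \<in> K"
begin

lemma K_Rats: "q \<in> K" if q: "q \<in> \<rat>"
proof -
  have zero: "0 \<in> K" using K_add[OF K_one K_uminus[OF K_one]] by simp
  have nat: "real n \<in> K" for n by (induction n) (auto intro: K_add K_one zero)
  have int: "real_of_int z \<in> K" for z
    by (cases z rule: int_cases2) (use nat K_uminus in auto)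
  obtain a b :: int where "q = of_int a / of_int b" using q by (rule Rats_cases')
  then show ?thesis using K_mult[OF int[of a] K_inverse[OF int[of b]]] by (simp add: divide_inverse)
qed

section \<open>Affine forms with coefficients in \<open>K\<close> and arbitrary real
  constants\<close>

inductive aff :: "((nat \<Rightarrow> real) \<Rightarrow> real) \<Rightarrow> bool" where
  aff_var: "aff (\<lambda>e. e i)"
| aff_const: "aff (\<lambda>e. c)"
| aff_add: "aff g \<Longrightarrow> aff h \<Longrightarrow> aff (\<lambda>e. g e + h e)"
| aff_scale: "k \<in> K \<Longrightarrow> aff g \<Longrightarrow> aff (\<lambda>e. k * g e)"

lemma aff_uminus: "aff g \<Longrightarrow> aff (\<lambda>e. - g e)"
  using aff_scale[OF K_uminus[OF K_one]] by simp

lemma aff_diff: "aff g \<Longrightarrow> aff h \<Longrightarrow> aff (\<lambda>e. g e - h e)"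
  using aff_add[of g "\<lambda>e. - h e"] aff_uminus by simp

lemma aff_divide: "k \<in> K \<Longrightarrow> aff g \<Longrightarrow> aff (\<lambda>e. g e / k)"
  using aff_scale[of "inverse k" g] K_inverse[of k] by (simp add: field_class.field_divide_inverse mult.commute)

lemma aff_sum: "(\<And>i. i \<in> A \<Longrightarrow> aff (g i)) \<Longrightarrow> aff (\<lambda>e. \<Sum>i\<in>A. g i e)"
  by (induction A rule: infinite_finite_induct) (auto intro: aff_const aff_add)

lemma aff_subst: "aff g \<Longrightarrow> (\<And>i. aff (\<lambda>e. s e i)) \<Longrightarrow> aff (\<lambda>e. g (s e))"
  by (induction rule: aff.induct) (auto intro: aff.intros)

lemma aff_If: "(P \<Longrightarrow> aff g) \<Longrightarrow> (\<not> P \<Longrightarrow> aff h) \<Longrightarrow> aff (\<lambda>e. if P then g e else h e)"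
  by (cases P) auto

lemma aff_upd: "aff u \<Longrightarrow> aff (\<lambda>e. (e(j := u e)) i)"
  by (cases "i = j") (auto intro: aff_var)

lemma aff_support:
  "aff g \<Longrightarrow> \<exists>Z. finite Z \<and> (\<forall>e e'. (\<forall>i\<in>Z. e i = e' i) \<longrightarrow> g e = g e')"
proof (induction rule: aff.induct)
  case (aff_var i)
  show ?case by (intro exI[of _ "{i}"]) auto
next
  case (aff_const c)
  show ?case by (intro exI[of _ "{}"]) auto
next
  case (aff_add g h)
  then obtain Z Y where "finite Z" "\<forall>e e'. (\<forall>i\<in>Z. e i = e' i) \<longrightarrow> g e = g e'"
     "finite Y" "\<forall>e e'. (\<forall>i\<in>Y. e i = e' i) \<longrightarrow> h e = h e'" by blast
  then show ?case by (intro exI[of _ "Z \<union> Y"]) (metis UnCI finite_Un)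
next
  case (aff_scale k g)
  then show ?case by metis
qed

lemma aff_coeff: "aff g \<Longrightarrow> \<exists>k\<in>K. \<forall>e x. g (e(j := x)) = g (e(j := 0)) + k * x"
proof (induction rule: aff.induct)
  case (aff_var i)
  show ?case
    by (cases "i = j") (auto intro: bexI[of _ 1] bexI[of _ 0] simp: K_one K_Rats)
next
  case (aff_const c)
  show ?case by (intro bexI[of _ 0]) (auto simp: K_Rats)
next
  case (aff_add g h)
  then obtain k l where "k \<in> K" "\<forall>e x. g (e(j := x)) = g (e(j := 0)) + k * x"
    "l \<in> K" "\<forall>e x. h (e(j := x)) = h (e(j := 0)) + l * x" by blast
  then have "g (e(j := x)) + h (e(j := x)) = g (e(j := 0)) + h (e(j := 0)) + (k + l) * x" for e x
    using distrib_right[of k l x] by (metis add.assoc add.left_commute)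
  then show ?case using K_add[OF \<open>k \<in> K\<close> \<open>l \<in> K\<close>] by blast
next
  case (aff_scale c g)
  then obtain k where "k \<in> K" "\<forall>e x. g (e(j := x)) = g (e(j := 0)) + k * x" by blast
  then have "c * g (e(j := x)) = c * g (e(j := 0)) + (c * k) * x" for e x
    by (metis distrib_left mult.assoc)
  then show ?case using K_mult[OF \<open>c \<in> K\<close> \<open>k \<in> K\<close>] by blast
qed

text \<open>On environments that vanish outside \<open>Z\<close>, a form becomes a sum over an index
  set fixed in advance. One \<open>Z\<close> thus serves all equations of a system.\<close>

lemma aff_coeffs:
  assumes "finite Z"
  shows "aff g \<Longrightarrow> \<exists>k. (\<forall>i. k i \<in> K) \<and>
     (\<forall>e. (\<forall>i. i \<notin> Z \<longrightarrow> e i = 0) \<longrightarrow> g e = g (\<lambda>_. 0) + (\<Sum>i\<in>Z. k i * e i))"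
proof (induction rule: aff.induct)
  case (aff_var j)
  show ?case
    by (intro exI[of _ "\<lambda>i. if i = j then 1 else 0"])
       (auto simp: K_one K_Rats if_distrib[of "\<lambda>x. x * _"] \<open>finite Z\<close> cong: if_cong)
next
  case (aff_const c)
  show ?case by (intro exI[of _ "\<lambda>_. 0"]) (auto simp: K_Rats)
next
  case (aff_add g h)
  then obtain k l where kl: "\<forall>i. k i \<in> K" "\<forall>e. (\<forall>i. i \<notin> Z \<longrightarrow> e i = 0) \<longrightarrow> g e = g (\<lambda>_. 0) + (\<Sum>i\<in>Z. k i * e i)"
    "\<forall>i. l i \<in> K" "\<forall>e. (\<forall>i. i \<notin> Z \<longrightarrow> e i = 0) \<longrightarrow> h e = h (\<lambda>_. 0) + (\<Sum>i\<in>Z. l i * e i)" by blast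
  have "g e + h e = g (\<lambda>_. 0) + h (\<lambda>_. 0) + (\<Sum>i\<in>Z. (k i + l i) * e i)"
    if "\<forall>i. i \<notin> Z \<longrightarrow> e i = 0" for e
    using kl(2)[rule_format, of e] kl(4)[rule_format, of e] that by (simp add: distrib_right sum.distrib)
  then show ?case using K_add \<open>\<forall>i. k i \<in> K\<close> \<open>\<forall>i. l i \<in> K\<close> by (intro exI[of _ "\<lambda>i. k i + l i"]) blast
next
  case (aff_scale c g)
  then obtain k where k: "\<forall>i. k i \<in> K" "\<forall>e. (\<forall>i. i \<notin> Z \<longrightarrow> e i = 0) \<longrightarrow> g e = g (\<lambda>_. 0) + (\<Sum>i\<in>Z. k i * e i)"
    by blast
  have "c * g e = c * g (\<lambda>_. 0) + (\<Sum>i\<in>Z. (c * k i) * e i)"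
    if "\<forall>i. i \<notin> Z \<longrightarrow> e i = 0" for e
    using k(2)[rule_format, of e] that by (simp add: distrib_left mult.assoc sum_distrib_left)
  then show ?case using K_mult[OF \<open>c \<in> K\<close>] \<open>\<forall>i. k i \<in> K\<close> by (intro exI[of _ "\<lambda>i. c * k i"]) blast
qed

text \<open>For affine \<open>g\<close> this is the linear part, the homogeneous form with the same
  coefficients.\<close>

definition lin :: "((nat \<Rightarrow> real) \<Rightarrow> real) \<Rightarrow> (nat \<Rightarrow> real) \<Rightarrow> real" where
  "lin g v = g v - g (\<lambda>_. 0)"

lemma aff_shift: "aff g \<Longrightarrow> g (\<lambda>i. e i + t * v i) = g e + t * lin g v"
proof (induction rule: aff.induct)
  case (aff_add g h)
  show ?case unfolding aff_add.IH by (simp add: lin_def algebra_simps)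
next
  case (aff_scale k g)
  show ?case unfolding aff_scale.IH by (simp add: lin_def algebra_simps)
qed (simp_all add: lin_def)

section \<open>Finite systems of affine forms\<close>

definition asys :: "((nat \<Rightarrow> real) \<Rightarrow> real) set \<Rightarrow> bool" where
  "asys E \<longleftrightarrow> finite E \<and> (\<forall>g\<in>E. aff g)"

lemma asys_empty: "asys {}" and asys_insert: "aff g \<Longrightarrow> asys E \<Longrightarrow> asys (insert g E)"
  and asys_Un: "asys E \<Longrightarrow> asys F \<Longrightarrow> asys (E \<union> F)"
  and asysD: "asys E \<Longrightarrow> g \<in> E \<Longrightarrow> aff g" and asys_finite: "asys E \<Longrightarrow> finite E"
  and asys_image: "finite A \<Longrightarrow> (\<And>a. a \<in> A \<Longrightarrow> aff (f a)) \<Longrightarrow> asys (f ` A)"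
  by (auto simp: asys_def)

lemma asys_subset: "asys E \<Longrightarrow> F \<subseteq> E \<Longrightarrow> asys F"
  unfolding asys_def using finite_subset by blast

definition pull :: "((nat \<Rightarrow> real) \<Rightarrow> nat \<Rightarrow> real) \<Rightarrow> ((nat \<Rightarrow> real) \<Rightarrow> real) set \<Rightarrow> ((nat \<Rightarrow> real) \<Rightarrow> real) set" where
  "pull s E = (\<lambda>g e. g (s e)) ` E"

lemma asys_pull: "asys E \<Longrightarrow> (\<And>i. aff (\<lambda>e. s e i)) \<Longrightarrow> asys (pull s E)"
  unfolding asys_def pull_def by (auto intro: aff_subst)

lemma asys_support:
  assumes "asys E"
  obtains Z where "finite Z" "\<And>e e' g. \<lbrakk>\<And>i. i \<in> Z \<Longrightarrow> e i = e' i; g \<in> E\<rbrakk> \<Longrightarrow> g e = g e'"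
proof -
  have "\<forall>g\<in>E. \<exists>Z. finite Z \<and> (\<forall>e e'. (\<forall>i\<in>Z. e i = e' i) \<longrightarrow> g e = g e')"
    using aff_support assms asysD by blast
  then obtain Y where Y: "\<forall>g\<in>E. finite (Y g) \<and> (\<forall>e e'. (\<forall>i\<in>Y g. e i = e' i) \<longrightarrow> g e = g e')"
    by metis
  show thesis
  proof (rule that[of "\<Union>g\<in>E. Y g"])
    show "finite (\<Union>g\<in>E. Y g)" using Y asys_finite[OF assms] by blast
    show "g e = g e'" if "\<And>i. i \<in> (\<Union>g\<in>E. Y g) \<Longrightarrow> e i = e' i" "g \<in> E" for e e' g
      using Y that by (metis UN_I)
  qed
qed

text \<open>Strict inequalities are open along every line: by \<open>aff_shift\<close> each form is
  continuous in \<open>t\<close>, and finitely many neighbourhoods of 0 have a common one. No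
  topology on environments is involved.\<close>

lemma asys_open:
  assumes "asys H" "\<forall>h\<in>H. 0 < h e"
  shows "\<exists>d>0. \<forall>t. \<bar>t\<bar> < d \<longrightarrow> (\<forall>h\<in>H. 0 < h (\<lambda>i. e i + t * v i))"
proof -
  have "\<forall>h\<in>H. \<forall>\<^sub>F t in nhds 0. 0 < h (\<lambda>i. e i + t * v i)"
  proof
    fix h assume h: "h \<in> H"
    have "((\<lambda>t. h e + t * lin h v) \<longlongrightarrow> h e + 0 * lin h v) (nhds 0)"
      by (intro tendsto_intros filterlim_ident)
    from order_tendstoD(1)[OF this, of 0] assms(2) h
    show "\<forall>\<^sub>F t in nhds 0. 0 < h (\<lambda>i. e i + t * v i)"
      by (simp add: aff_shift[OF asysD[OF assms(1) h]])
  qed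
  then have "\<forall>\<^sub>F t in nhds 0. \<forall>h\<in>H. 0 < h (\<lambda>i. e i + t * v i)"
    using asys_finite[OF assms(1)] by (simp add: eventually_ball_finite)
  then show ?thesis unfolding eventually_nhds_metric by (simp add: dist_real_def)
qed

definition basic :: "((nat \<Rightarrow> real) \<Rightarrow> real) set \<Rightarrow> ((nat \<Rightarrow> real) \<Rightarrow> real) set \<Rightarrow> (nat \<Rightarrow> real) \<Rightarrow> bool" where
  "basic E G e \<longleftrightarrow> (\<forall>g\<in>E. g e = 0) \<and> (\<forall>h\<in>G. 0 < h e)"

end

section \<open>Fourier-Motzkin elimination and rational quantifiers\<close>

context real_subfield begin

section \<open>Elimination of one real variable\<close>

lemma basic_pull: "basic (pull s E) (pull s G) e \<longleftrightarrow> basic E G (s e)"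
  by (auto simp: basic_def pull_def)

lemma basic_Un: "basic (E \<union> E') (G \<union> G') e \<longleftrightarrow> basic E G e \<and> basic E' G' e"
  by (auto simp: basic_def)

lemma affine_coefficient:
  assumes "aff g"
  obtains k where "k \<in> K" "\<And>e x. g (e(j := x)) = g (e(j := 0)) + k * x"
  using aff_coeff[OF assms, of j] by blast

text \<open>A single change of value in direction \<open>j\<close> shows that the coefficient of
  \<open>j\<close> is nonzero, and dividing by it stays inside \<open>K\<close>.\<close>

lemma solve_for_variable:
  assumes "aff g" "g (e0(j := x0)) \<noteq> g (e0(j := 0))"
  obtains u where "aff u" "\<And>e x. g (e(j := x)) = 0 \<longleftrightarrow> x = u e"
proof -
  obtain k where k: "k \<in> K" "\<And>e x. g (e(j := x)) = g (e(j := 0)) + k * x"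
    using affine_coefficient[OF assms(1)] by blast
  then have "k \<noteq> 0" using assms(2) by (metis add.right_neutral mult_zero_left)
  show thesis
  proof (rule that[of "\<lambda>e. - (g (e(j := 0)) / k)"])
    show "aff (\<lambda>e. - (g (e(j := 0)) / k))"
      by (intro aff_uminus aff_divide k aff_subst[OF assms(1)] aff_upd aff_const)
    show "g (e(j := x)) = 0 \<longleftrightarrow> x = - (g (e(j := 0)) / k)" for e x
      by (subst k(2)) (use \<open>k \<noteq> 0\<close> in \<open>auto simp: field_simps add_eq_0_iff2\<close>)
  qed
qed

text \<open>An equation that involves the variable determines it and is used for substitution. If
  there is none, Fourier-Motzkin elimination compares every lower bound with every upper bound.
  Either way the result is again a single conjunction, with no case distinction left in it.\<close>

lemma basic_ex:
  assumes E: "asys E" and G: "asys G"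
  obtains E' G' where "asys E'" "asys G'" "\<And>e. (\<exists>x. basic E G (e(j := x))) \<longleftrightarrow> basic E' G' e"
proof (cases "\<exists>g\<in>E. \<exists>e x. g (e(j := x)) \<noteq> g (e(j := 0))")
  case True
  then obtain g e0 x0 where g: "g \<in> E" "g (e0(j := x0)) \<noteq> g (e0(j := 0))" by blast
  obtain u where u: "aff u" "\<And>e x. g (e(j := x)) = 0 \<longleftrightarrow> x = u e"
    using solve_for_variable[OF asysD[OF E g(1)] g(2)] by blast
  let ?s = "\<lambda>e. e(j := u e)"
  have "(\<exists>x. basic E G (e(j := x))) \<longleftrightarrow> basic E G (?s e)" for e
    using u(2)[of e] g(1) unfolding basic_def by metis
  then show thesis using that[of "pull ?s E" "pull ?s G"] E G
    by (simp add: basic_pull asys_pull aff_upd[OF u(1)] del: fun_upd_apply)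
next
  case False
  then have Ej: "g (e(j := x)) = g (e(j := 0))" if "g \<in> E" for g e x using that by blast
  have "\<forall>h\<in>G. \<exists>k\<in>K. \<forall>e x. h (e(j := x)) = h (e(j := 0)) + k * x"
    using aff_coeff asysD[OF G] by blast
  then obtain k where k: "\<And>h. h \<in> G \<Longrightarrow> k h \<in> K"
    "\<And>h e x. h \<in> G \<Longrightarrow> h (e(j := x)) = h (e(j := 0)) + k h * x" by metis
  \<comment> \<open>The value of the variable at which \<open>h\<close> vanishes: a lower bound if
    the coefficient \<open>k h\<close> is positive, an upper bound if it is negative.\<close>
  let ?b = "\<lambda>h e. - (h (e(j := 0)) / k h)"
  let ?L = "{h \<in> G. k h > 0}" and ?U = "{h \<in> G. k h < 0}" and ?Z = "{h \<in> G. k h = 0}"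
  define E' where "E' = pull (\<lambda>e. e(j := 0)) E"
  define G' where "G' = pull (\<lambda>e. e(j := 0)) ?Z \<union> (\<lambda>(a, b) e. ?b b e - ?b a e) ` (?L \<times> ?U)"
  have fin: "finite ?L" "finite ?U" using asys_finite[OF G] by auto
  have b: "aff (?b h)" if "h \<in> G" for h
    by (intro aff_uminus aff_divide k aff_subst[OF asysD[OF G that]] aff_upd aff_const that)
  have "asys E'" unfolding E'_def by (intro asys_pull E aff_upd aff_const)
  moreover have "asys G'" unfolding G'_def
  proof (rule asys_Un)
    show "asys (pull (\<lambda>e. e(j := 0)) ?Z)"
      by (intro asys_pull asys_subset[OF G] aff_upd aff_const) blast
    show "asys ((\<lambda>(a, b) e. ?b b e - ?b a e) ` (?L \<times> ?U))"
      using fin b by (intro asys_image) (auto simp only: split: prod.split intro!: aff_diff)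
  qed
  moreover have "(\<exists>x. basic E G (e(j := x))) \<longleftrightarrow> basic E' G' e" for e
  proof -
    have pos: "0 < h (e(j := x)) \<longleftrightarrow>
      (if k h > 0 then ?b h e < x else if k h < 0 then x < ?b h e else 0 < h (e(j := 0)))"
      if "h \<in> G" for h x
      by (subst k(2)[OF that]) (auto simp: field_simps)
    have "(\<forall>h\<in>G. 0 < h (e(j := x))) \<longleftrightarrow> (\<forall>h\<in>?Z. 0 < h (e(j := 0))) \<and>
      (\<forall>h\<in>?L. ?b h e < x) \<and> (\<forall>h\<in>?U. x < ?b h e)" for x
      unfolding ball_sign_split[symmetric] by (intro ball_cong refl pos)
    moreover have "(\<forall>g\<in>E. g (e(j := x)) = 0) \<longleftrightarrow> (\<forall>g\<in>E'. g e = 0)" for x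
      unfolding E'_def pull_def ball_simps
      by (rule ball_cong[OF refl], subst Ej) (assumption, rule refl)
    ultimately have 1: "(\<exists>x. basic E G (e(j := x))) \<longleftrightarrow> basic E' (pull (\<lambda>e. e(j := 0)) ?Z) e \<and>
      (\<exists>x. (\<forall>a\<in>(\<lambda>h. ?b h e) ` ?L. a < x) \<and> (\<forall>c\<in>(\<lambda>h. ?b h e) ` ?U. x < c))"
      unfolding basic_def pull_def ball_simps by simp
    have 2: "(\<exists>x. (\<forall>a\<in>(\<lambda>h. ?b h e) ` ?L. a < x) \<and> (\<forall>c\<in>(\<lambda>h. ?b h e) ` ?U. x < c)) \<longleftrightarrow>
      (\<forall>a\<in>?L. \<forall>c\<in>?U. ?b a e < ?b c e)" (is "?l = ?r")
    proof
      assume ?l then show ?r by (meson imageI less_trans)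
    next
      assume ?r then show ?l using fin by (intro ex_between_finite) auto
    qed
    show ?thesis unfolding 1 2 unfolding basic_def G'_def by (auto simp: ball_Un)
  qed
  ultimately show thesis by (rule that)
qed

section \<open>Blocks of rational quantifiers\<close>

text \<open>The values of \<open>e\<close> at the variables in \<open>J\<close> are overwritten, hence irrelevant.\<close>

definition qex :: "nat set \<Rightarrow> ((nat \<Rightarrow> real) \<Rightarrow> bool) \<Rightarrow> (nat \<Rightarrow> real) \<Rightarrow> bool" where
  "qex J P e \<longleftrightarrow> (\<exists>e'. (\<forall>i. i \<notin> J \<longrightarrow> e' i = e i) \<and> (\<forall>i\<in>J. e' i \<in> \<rat>) \<and> P e')"

lemma qexI: "\<lbrakk>\<And>i. i \<notin> J \<Longrightarrow> e' i = e i; \<And>i. i \<in> J \<Longrightarrow> e' i \<in> \<rat>; P e'\<rbrakk> \<Longrightarrow> qex J P e"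
  unfolding qex_def by blast

lemma qexE:
  assumes "qex J P e"
  obtains e' where "\<And>i. i \<notin> J \<Longrightarrow> e' i = e i" "\<And>i. i \<in> J \<Longrightarrow> e' i \<in> \<rat>" "P e'"
  using assms unfolding qex_def by blast

lemma qex_empty: "qex {} P = P"
proof
  fix e
  have "(\<forall>i. i \<notin> {} \<longrightarrow> e' i = e i) \<longleftrightarrow> e' = e" for e' :: "nat \<Rightarrow> real" by auto
  then show "qex {} P e = P e" by (simp add: qex_def)
qed

lemma qex_qex: "qex J (qex J' P) = qex (J \<union> J') P"
proof (intro ext iffI)
  fix e assume "qex J (qex J' P) e"
  then obtain e1 where e1: "\<And>i. i \<notin> J \<Longrightarrow> e1 i = e i" "\<And>i. i \<in> J \<Longrightarrow> e1 i \<in> \<rat>" "qex J' P e1"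
    by (rule qexE) blast
  then obtain e2 where e2: "\<And>i. i \<notin> J' \<Longrightarrow> e2 i = e1 i" "\<And>i. i \<in> J' \<Longrightarrow> e2 i \<in> \<rat>" "P e2"
    by (elim qexE) blast
  have "e2 i \<in> \<rat>" if "i \<in> J \<union> J'" for i using that e1 e2 by (cases "i \<in> J'") auto
  then show "qex (J \<union> J') P e" using e1 e2 by (intro qexI[of _ e2]) auto
next
  fix e assume "qex (J \<union> J') P e"
  then obtain e2 where e2: "\<And>i. i \<notin> J \<union> J' \<Longrightarrow> e2 i = e i" "\<And>i. i \<in> J \<union> J' \<Longrightarrow> e2 i \<in> \<rat>" "P e2"
    by (elim qexE) blast
  show "qex J (qex J' P) e"
    by (rule qexI[of _ "\<lambda>i. if i \<in> J then e2 i else e i"])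
       (use e2 in \<open>auto intro: qexI[of _ e2]\<close>)
qed

lemma qex_single: "qex {j} P e \<longleftrightarrow> (\<exists>r\<in>\<rat>. P (e(j := r)))"
proof
  assume "qex {j} P e"
  then obtain e' where e': "\<And>i. i \<notin> {j} \<Longrightarrow> e' i = e i" "\<And>i. i \<in> {j} \<Longrightarrow> e' i \<in> \<rat>" "P e'"
    by (elim qexE) blast
  then have "e(j := e' j) = e'" by auto
  then show "\<exists>r\<in>\<rat>. P (e(j := r))" using e' by (metis insertI1)
next
  assume "\<exists>r\<in>\<rat>. P (e(j := r))"
  then obtain r where "r \<in> \<rat>" "P (e(j := r))" by blast
  then show "qex {j} P e" by (intro qexI[of _ "e(j := r)"]) auto
qed

lemma qex_conj:
  assumes "\<And>e e'. (\<And>i. i \<notin> J \<Longrightarrow> e i = e' i) \<Longrightarrow> R e = R e'"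
  shows "qex J P e \<and> R e \<longleftrightarrow> qex J (\<lambda>e. P e \<and> R e) e"
  unfolding qex_def using assms by metis

text \<open>A semantic substitute for a set containing the free variables; fresh variables are
  chosen outside it.\<close>

definition supp :: "nat set \<Rightarrow> ((nat \<Rightarrow> real) \<Rightarrow> bool) \<Rightarrow> bool" where
  "supp Z P \<longleftrightarrow> finite Z \<and> (\<forall>e e'. (\<forall>i\<in>Z. e i = e' i) \<longrightarrow> P e = P e')"

lemma suppD: "supp Z P \<Longrightarrow> (\<And>i. i \<in> Z \<Longrightarrow> e i = e' i) \<Longrightarrow> P e = P e'"
  unfolding supp_def by metis

lemma basic_supp:
  assumes "asys E" "asys G"
  obtains Z where "supp Z (basic E G)"
proof -
  obtain Z where "finite Z" "\<And>e e' g. \<lbrakk>\<And>i. i \<in> Z \<Longrightarrow> e i = e' i; g \<in> E \<union> G\<rbrakk> \<Longrightarrow> g e = g e'"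
    using asys_support[OF asys_Un[OF assms]] by blast
  then have "supp Z (basic E G)" unfolding supp_def basic_def by (metis UnCI)
  then show thesis by (rule that)
qed

lemma qex_supp: "supp Z P \<Longrightarrow> supp Z (qex J P)"
proof -
  assume Z: "supp Z P"
  have "qex J P e'" if q: "qex J P e" and ee': "\<forall>i\<in>Z. e i = e' i" for e e'
  proof -
    obtain e1 where e1: "\<And>i. i \<notin> J \<Longrightarrow> e1 i = e i" "\<And>i. i \<in> J \<Longrightarrow> e1 i \<in> \<rat>" "P e1"
      using q by (elim qexE) blast
    have "P (\<lambda>i. if i \<in> J then e1 i else e' i) = P e1" by (rule suppD[OF Z]) (use ee' e1(1) in auto)
    then show ?thesis using e1 by (intro qexI[of _ "\<lambda>i. if i \<in> J then e1 i else e' i"]) auto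
  qed
  then show ?thesis using Z unfolding supp_def by metis
qed

section \<open>Rational projections of basic conditions\<close>

definition special :: "((nat \<Rightarrow> real) \<Rightarrow> bool) \<Rightarrow> bool" where
  "special S \<longleftrightarrow> (\<exists>J E G. finite J \<and> asys E \<and> asys G \<and> S = qex J (basic E G))"

text \<open>Without inequalities, moving a witness along a rational kernel direction of the
  equations is possible without any bound. This makes such conditions all-or-nothing along
  lines.\<close>

definition equational :: "((nat \<Rightarrow> real) \<Rightarrow> bool) \<Rightarrow> bool" where
  "equational S \<longleftrightarrow> (\<exists>J E. finite J \<and> asys E \<and> S = qex J (basic E {}))"

lemma equational_special: "equational S \<Longrightarrow> special S"
  unfolding equational_def special_def using asys_empty by blast

lemma special_supp: "special S \<Longrightarrow> \<exists>Z. supp Z S"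
  unfolding special_def using basic_supp qex_supp by metis

lemma qex_special: "special S \<Longrightarrow> finite J \<Longrightarrow> special (qex J S)"
  unfolding special_def by (metis qex_qex finite_UnI)

text \<open>Taking \<open>s\<close> to be the identity, this is a renaming of the bound variables away from \<open>A\<close>.\<close>

lemma special_subst_fresh:
  assumes J: "finite J" and E: "asys E" and G: "asys G" and "finite A"
    and s: "\<And>i. aff (\<lambda>e. s e i)"
  obtains J' t where "finite J'" "J' \<inter> A = {}" "\<And>i. aff (\<lambda>e. t e i)"
    "(\<lambda>e. qex J (basic E G) (s e)) = qex J' (basic (pull t E) (pull t G))"
proof -
  obtain Y where Y: "supp Y (basic E G)" using basic_supp[OF E G] by blast
  have "\<forall>i. \<exists>Z. finite Z \<and> (\<forall>e e'. (\<forall>k\<in>Z. e k = e' k) \<longrightarrow> s e i = s e' i)"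
    using aff_support[OF s] by simp
  then obtain Z where Z: "\<And>i. finite (Z i)" "\<And>i e e'. (\<forall>k\<in>Z i. e k = e' k) \<longrightarrow> s e i = s e' i"
    by metis
  have "finite (A \<union> (\<Union>i\<in>Y. Z i))" using Y Z(1) \<open>finite A\<close> by (simp add: supp_def)
  then obtain N where N: "\<forall>n \<in> A \<union> (\<Union>i\<in>Y. Z i). n < N"
    using finite_nat_set_iff_bounded by metis
  \<comment> \<open>\<open>N\<close> exceeds \<open>A\<close> and the supports \<open>Z i\<close> of
    the entries of \<open>s\<close> that matter, so the shifted block is fresh. The map
    \<open>t\<close> reads bound variables from their shifted copies and acts as \<open>s\<close> on
    the others.\<close>
  define J' where "J' = (\<lambda>j. j + N) ` J"
  define t where "t e i = (if i \<in> J then e (i + N) else s e i)" for e i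
  have J'N: "N \<le> k" if "k \<in> J'" for k using that by (auto simp: J'_def)
  have fresh: "k \<notin> J'" if "k \<in> A \<union> (\<Union>i\<in>Y. Z i)" for k
    using J'N[of k] bspec[OF N that] not_less by blast
  have "qex J (basic E G) (s e) \<longleftrightarrow> qex J' (\<lambda>e. basic E G (t e)) e" for e
  proof
    assume "qex J (basic E G) (s e)"
    then obtain e1 where e1: "\<And>i. i \<notin> J \<Longrightarrow> e1 i = s e i" "\<And>i. i \<in> J \<Longrightarrow> e1 i \<in> \<rat>" "basic E G e1"
      by (elim qexE) blast
    define e' where "e' k = (if k \<in> J' then e1 (k - N) else e k)" for k
    have "t e' i = e1 i" if "i \<in> Y" for i
    proof (cases "i \<in> J")
      case True
      then show ?thesis by (auto simp: t_def e'_def J'_def)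
    next
      case False
      have "k \<notin> J'" if "k \<in> Z i" for k using fresh \<open>i \<in> Y\<close> that by blast
      then have "s e' i = s e i" using Z(2)[of i e' e] by (simp add: e'_def)
      then show ?thesis using False e1(1) by (simp add: t_def)
    qed
    then have "basic E G (t e')" using suppD[OF Y, of "t e'" e1] e1(3) by simp
    moreover have "e' i \<in> \<rat>" if "i \<in> J'" for i using that e1(2) by (auto simp: e'_def J'_def)
    ultimately show "qex J' (\<lambda>e. basic E G (t e)) e" by (intro qexI[of _ e']) (auto simp: e'_def)
  next
    assume "qex J' (\<lambda>e. basic E G (t e)) e"
    then obtain e' where e': "\<And>i. i \<notin> J' \<Longrightarrow> e' i = e i" "\<And>i. i \<in> J' \<Longrightarrow> e' i \<in> \<rat>" "basic E G (t e')"
      by (elim qexE) blast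
    define e1 where "e1 i = (if i \<in> J then e' (i + N) else s e i)" for i
    have "t e' i = e1 i" if "i \<in> Y" for i
    proof -
      have "k \<notin> J'" if "k \<in> Z i" for k using fresh \<open>i \<in> Y\<close> that by blast
      then show ?thesis using Z(2)[of i e' e] e'(1) by (simp add: t_def e1_def)
    qed
    then have "basic E G e1" using suppD[OF Y, of "t e'" e1] e'(3) by simp
    moreover have "e1 i \<in> \<rat>" if "i \<in> J" for i using that e'(2) by (auto simp: e1_def J'_def)
    ultimately show "qex J (basic E G) (s e)" by (intro qexI[of _ e1]) (auto simp: e1_def)
  qed
  then have "(\<lambda>e. qex J (basic E G) (s e)) = qex J' (basic (pull t E) (pull t G))"
    by (simp add: basic_pull fun_eq_iff qex_def)
  moreover have "J' \<inter> A = {}" using fresh by blast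
  moreover have "finite J'" using J by (simp add: J'_def)
  moreover have "aff (\<lambda>e. t e i)" for i unfolding t_def by (intro aff_If aff_var s)
  ultimately show thesis using that by blast
qed

lemma special_subst:
  assumes "special S" "\<And>i. aff (\<lambda>e. s e i)"
  shows "special (\<lambda>e. S (s e))"
proof -
  obtain J E G where S: "finite J" "asys E" "asys G" "S = qex J (basic E G)"
    using assms(1) unfolding special_def by blast
  obtain J' t where "finite J'" "\<And>i. aff (\<lambda>e. t e i)"
    "(\<lambda>e. qex J (basic E G) (s e)) = qex J' (basic (pull t E) (pull t G))"
    using special_subst_fresh[of J E G "{}" s] S assms(2) by (metis finite.emptyI)
  then show ?thesis unfolding special_def S(4) using asys_pull S by blast
qed

lemma equational_subst:
  assumes "equational S" "\<And>i. aff (\<lambda>e. s e i)"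
  shows "equational (\<lambda>e. S (s e))"
proof -
  obtain J E where S: "finite J" "asys E" "S = qex J (basic E {})"
    using assms(1) unfolding equational_def by blast
  obtain J' t where t: "finite J'" "\<And>i. aff (\<lambda>e. t e i)"
    "(\<lambda>e. qex J (basic E {}) (s e)) = qex J' (basic (pull t E) (pull t {}))"
    using special_subst_fresh[of J E "{}" "{}" s] S assms(2) asys_empty by (metis finite.emptyI)
  have "pull t {} = {}" by (simp add: pull_def)
  then show ?thesis unfolding equational_def S(3) using t asys_pull S by metis
qed

lemma special_fresh:
  assumes "special S" "finite A"
  obtains J E G where "finite J" "asys E" "asys G" "J \<inter> A = {}" "S = qex J (basic E G)"
proof -
  obtain J E G where S: "finite J" "asys E" "asys G" "S = qex J (basic E G)"
    using assms(1) unfolding special_def by blast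
  obtain J' t where t: "finite J'" "J' \<inter> A = {}" "\<And>i. aff (\<lambda>e. t e i)"
    "(\<lambda>e. qex J (basic E G) e) = qex J' (basic (pull t E) (pull t G))"
    using special_subst_fresh[of J E G A "\<lambda>e. e"] S assms(2) aff_var by metis
  show thesis
    by (rule that[of J' "pull t E" "pull t G"]) (use t S asys_pull in auto)
qed

text \<open>Both blocks are moved to the front. The block of \<open>S\<close> is chosen off the
  support of \<open>S'\<close>; then that of \<open>S'\<close> is chosen off the support of the
  whole matrix of \<open>S\<close>, including the variables already bound there.\<close>

lemma special_conj:
  assumes "special S" "special S'"
  shows "special (\<lambda>e. S e \<and> S' e)"
proof -
  obtain Z where Z: "supp Z S'" using special_supp assms(2) by blast
  then obtain J E G where S: "finite J" "asys E" "asys G" "J \<inter> Z = {}" "S = qex J (basic E G)"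
    using special_fresh[OF assms(1)] unfolding supp_def by metis
  obtain Y where Y: "supp Y (basic E G)" using basic_supp S by blast
  then obtain J' E' G' where S': "finite J'" "asys E'" "asys G'" "J' \<inter> Y = {}" "S' = qex J' (basic E' G')"
    using special_fresh[OF assms(2)] unfolding supp_def by metis
  have 1: "(\<lambda>e. S e \<and> S' e) = qex J (\<lambda>e. basic E G e \<and> S' e)"
    unfolding S(5) by (rule ext, rule qex_conj, rule suppD[OF Z]) (use S(4) in blast)
  have "basic E G e \<and> S' e \<longleftrightarrow> qex J' (\<lambda>e. basic E' G' e \<and> basic E G e) e" for e
    unfolding S'(5) conj_commute[of "basic E G e"]
    by (rule qex_conj, rule suppD[OF Y]) (use S'(4) in blast)
  then have 2: "(\<lambda>e. basic E G e \<and> S' e) = qex J' (basic (E' \<union> E) (G' \<union> G))"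
    by (simp add: basic_Un[abs_def])
  have "(\<lambda>e. S e \<and> S' e) = qex (J \<union> J') (basic (E' \<union> E) (G' \<union> G))"
    unfolding 1 2 qex_qex ..
  then show ?thesis unfolding special_def
    by (intro exI[of _ "J \<union> J'"] exI[of _ "E' \<union> E"] exI[of _ "G' \<union> G"])
       (simp add: S(1-3) S'(1-3) asys_Un)
qed

end

section \<open>Unique rational witnesses and negation\<close>

inductive funion :: "(('a \<Rightarrow> bool) \<Rightarrow> bool) \<Rightarrow> ('a \<Rightarrow> bool) \<Rightarrow> bool" for C where
  funion_empty: "funion C (\<lambda>_. False)"
| funion_insert: "C p \<Longrightarrow> funion C q \<Longrightarrow> funion C (\<lambda>e. p e \<or> q e)"

lemma funion_base: "C p \<Longrightarrow> funion C p"
  using funion_insert[of C p "\<lambda>_. False"] funion_empty[of C] by simp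

lemma funion_disj: "funion C p \<Longrightarrow> funion C q \<Longrightarrow> funion C (\<lambda>e. p e \<or> q e)"
proof (induction rule: funion.induct)
  case (funion_insert p p')
  then show ?case using funion.funion_insert[of C p "\<lambda>e. p' e \<or> q e"] by (simp add: disj_assoc)
qed simp

lemma funion_Bex:
  "finite A \<Longrightarrow> (\<And>a. a \<in> A \<Longrightarrow> funion C (P a)) \<Longrightarrow> funion C (\<lambda>e. \<exists>a\<in>A. P a e)"
proof (induction A rule: finite_induct)
  case (insert a A)
  then show ?case using funion_disj[of C "P a" "\<lambda>e. \<exists>a\<in>A. P a e"] by simp
qed (simp add: funion_empty)

text \<open>An operation that commutes with finite disjunctions need only be treated on members of
  \<open>C\<close>. Substitution, both kinds of quantifier and closure are handled this way, for
  \<open>C = piece\<close> and for \<open>C = linset\<close>.\<close>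

lemma funion_bind:
  assumes "funion C p" "\<And>p. C p \<Longrightarrow> funion D (f p)" "f (\<lambda>_. False) = (\<lambda>_. False)"
    "\<And>p q. f (\<lambda>e. p e \<or> q e) = (\<lambda>e. f p e \<or> f q e)"
  shows "funion D (f p)"
  using assms(1)
proof (induction rule: funion.induct)
  case funion_empty
  show ?case unfolding assms(3) by (rule funion.funion_empty)
next
  case (funion_insert p q)
  then show ?case unfolding assms(4) using assms(2) funion_disj by blast
qed

lemma funion_conj:
  assumes "\<And>p q. C p \<Longrightarrow> C q \<Longrightarrow> C (\<lambda>e. p e \<and> q e)" and pq: "funion C p" "funion C q"
  shows "funion C (\<lambda>e. p e \<and> q e)"
proof (rule funion_bind[where f = "\<lambda>p e. p e \<and> q e", OF pq(1)])
  fix p assume p: "C p"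
  show "funion C (\<lambda>e. p e \<and> q e)"
    by (rule funion_bind[where f = "\<lambda>q e. p e \<and> q e", OF pq(2)])
       (auto simp: fun_eq_iff intro: funion_base assms(1) p)
qed (auto simp: fun_eq_iff)

lemma funion_not:
  assumes conj: "\<And>p q. C p \<Longrightarrow> C q \<Longrightarrow> C (\<lambda>e. p e \<and> q e)" and true: "C (\<lambda>_. True)"
    and "\<And>p. C p \<Longrightarrow> funion C (\<lambda>e. \<not> p e)" and "funion C p"
  shows "funion C (\<lambda>e. \<not> p e)"
  using assms(4)
proof (induction rule: funion.induct)
  case funion_empty
  show ?case using funion_base[of C, OF true] by simp
next
  case (funion_insert p q)
  then have "funion C (\<lambda>e. \<not> p e \<and> \<not> q e)" using funion_conj[of C, OF conj] assms(3) by blast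
  then show ?case by simp
qed

context real_subfield begin

section \<open>Uniqueness of rational witnesses\<close>

definition uniq :: "nat set \<Rightarrow> ((nat \<Rightarrow> real) \<Rightarrow> real) set \<Rightarrow> bool" where
  "uniq J E \<longleftrightarrow> (\<forall>e e'. (\<forall>i. i \<notin> J \<longrightarrow> e i = e' i) \<longrightarrow> (\<forall>i\<in>J. e i \<in> \<rat> \<and> e' i \<in> \<rat>) \<longrightarrow>
     (\<forall>g\<in>E. g e = 0 \<and> g e' = 0) \<longrightarrow> e = e')"

text \<open>Two distinct rational solutions differ by a rational kernel vector. After a shear this
  vector becomes a coordinate direction on which the equations do not depend, so the rational
  quantifier over that coordinate may be replaced by a real one and eliminated by
  \<open>basic_ex\<close>. The block shrinks until the equations alone determine the
  witness.\<close>

lemma special_uniq: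
  assumes "finite J" "asys E" "asys G"
  shows "\<exists>J' E' G'. finite J' \<and> asys E' \<and> asys G' \<and> uniq J' E' \<and> qex J (basic E G) = qex J' (basic E' G')"
  using assms
proof (induction "card J" arbitrary: J E G rule: less_induct)
  case less
  show ?case
  proof (cases "uniq J E")
    case True
    then show ?thesis using less.prems by blast
  next
    case False
    then obtain a b where ab: "\<And>i. i \<notin> J \<Longrightarrow> a i = b i" "\<And>i. i \<in> J \<Longrightarrow> a i \<in> \<rat> \<and> b i \<in> \<rat>"
      "\<And>g. g \<in> E \<Longrightarrow> g a = 0 \<and> g b = 0" "a \<noteq> b" unfolding uniq_def by blast
    then obtain j where j: "a j \<noteq> b j" by (meson ext)
    then have "j \<in> J" using ab(1) by blast
    \<comment> \<open>a rational kernel vector, along which the variable \<open>j\<close> is eliminated by the shear \<open>s\<close>\<close>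
    define v where "v i = (b i - a i) / (b j - a j)" for i
    have vj: "v j = 1" using j by (simp add: v_def)
    have v0: "v i = 0" if "i \<notin> J" for i using ab(1)[OF that] by (simp add: v_def)
    have vQ: "v i \<in> \<rat>" for i
    proof (cases "i \<in> J")
      case True
      then show ?thesis using ab(2)[of i] ab(2)[OF \<open>j \<in> J\<close>] by (simp add: v_def)
    qed (simp add: v0)
    have lin0: "lin g v = 0" if "g \<in> E" for g
    proof -
      have "b = (\<lambda>i. a i + (b j - a j) * v i)" using j by (auto simp: v_def)
      then have "g b = g a + (b j - a j) * lin g v"
        using aff_shift[OF asysD[OF less.prems(2) that], of a "b j - a j" v] by simp
      then show ?thesis using ab(3)[OF that] j by simp
    qed
    define s where "s e i = (if i = j then e j else e i + v i * e j)" for e :: "nat \<Rightarrow> real" and i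
    have s: "aff (\<lambda>e. s e i)" for i
      unfolding s_def by (intro aff_If aff_var aff_add aff_scale K_Rats vQ)
    have s_shift: "s (e(j := x + t)) = (\<lambda>i. s (e(j := x)) i + t * v i)" for e x t
      by (auto simp: s_def vj fun_eq_iff algebra_simps)
    obtain E' G' where E': "asys E'" "asys G'"
      "\<And>e. (\<exists>x. basic (pull s E) (pull s G) (e(j := x))) \<longleftrightarrow> basic E' G' e"
      using basic_ex[OF asys_pull asys_pull, of E s G s j] less.prems s by blast
    have "qex J (basic E G) e = qex (J - {j}) (basic E' G') e" for e
    proof
      assume "qex J (basic E G) e"
      then obtain e1 where e1: "\<And>i. i \<notin> J \<Longrightarrow> e1 i = e i" "\<And>i. i \<in> J \<Longrightarrow> e1 i \<in> \<rat>" "basic E G e1"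
        by (elim qexE) blast
      \<comment> \<open>This undoes the shear, except that entry \<open>j\<close> returns to
        \<open>e j\<close>, because \<open>j\<close> is no longer quantified.\<close>
      define e2 where "e2 i = (if i = j then e j else e1 i - v i * e1 j)" for i
      have "s (e2(j := e1 j)) = e1" by (auto simp: s_def e2_def fun_eq_iff)
      then have "basic E' G' e2" using e1(3) E'(3)[of e2] by (metis basic_pull)
      moreover have "e2 i = e i" if "i \<notin> J - {j}" for i
        using that e1(1)[of i] v0[of i] by (cases "i = j") (auto simp: e2_def)
      moreover have "e2 i \<in> \<rat>" if "i \<in> J - {j}" for i
        using that e1(2)[of i] e1(2)[OF \<open>j \<in> J\<close>] vQ[of i] by (simp add: e2_def)
      ultimately show "qex (J - {j}) (basic E' G') e" by (intro qexI[of _ e2])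
    next
      assume "qex (J - {j}) (basic E' G') e"
      then obtain e2 where e2: "\<And>i. i \<notin> J - {j} \<Longrightarrow> e2 i = e i" "\<And>i. i \<in> J - {j} \<Longrightarrow> e2 i \<in> \<rat>"
        "basic E' G' e2" by (elim qexE) blast
      then obtain x where x: "basic E G (s (e2(j := x)))" using E'(3)[of e2] by (auto simp: basic_pull)
      then have "\<forall>h\<in>G. 0 < h (s (e2(j := x)))" by (simp add: basic_def)
      from asys_open[OF less.prems(3) this, of v] obtain d where
        d: "0 < d" "\<And>t. \<bar>t\<bar> < d \<Longrightarrow> \<forall>h\<in>G. 0 < h (\<lambda>i. s (e2(j := x)) i + t * v i)" by blast
      \<comment> \<open>The real witness \<open>x\<close> is traded for a nearby rational one: along
        \<open>v\<close> the equations do not change and the inequalities survive a small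
        shift.\<close>
      obtain r where r: "r \<in> \<rat>" "x < r" "r < x + d" using Rats_dense_in_real[of x "x + d"] d(1) by auto
      have sr: "s (e2(j := r)) = (\<lambda>i. s (e2(j := x)) i + (r - x) * v i)" using s_shift[of e2 x "r - x"] by simp
      have "g (s (e2(j := r))) = 0" if "g \<in> E" for g
        using aff_shift[OF asysD[OF less.prems(2) that], of "s (e2(j := x))" "r - x" v] x lin0[OF that] that
        unfolding sr basic_def by simp
      then have "basic E G (s (e2(j := r)))" using d(2)[of "r - x"] r unfolding basic_def sr by simp
      moreover have "s (e2(j := r)) i = e i" if "i \<notin> J" for i
        using that \<open>j \<in> J\<close> e2(1)[of i] v0 by (auto simp: s_def)
      moreover have "s (e2(j := r)) i \<in> \<rat>" if "i \<in> J" for i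
        using that e2(2)[of i] vQ r(1) by (auto simp: s_def)
      ultimately show "qex J (basic E G) e" by (intro qexI[of _ "s (e2(j := r))"])
    qed
    then have "qex J (basic E G) = qex (J - {j}) (basic E' G')" by blast
    moreover have "card (J - {j}) < card J" using less.prems(1) \<open>j \<in> J\<close> by (rule card_Diff1_less)
    ultimately show ?thesis using less.hyps[of "J - {j}" E' G'] E' less.prems(1) by simp
  qed
qed

text \<open>Only equational conditions occur negatively. For these, along a line, there is the
  alternative between invariance and rare truth on which both quantifier eliminations rest.\<close>

definition piece :: "((nat \<Rightarrow> real) \<Rightarrow> bool) \<Rightarrow> bool" where
  "piece P \<longleftrightarrow> (\<exists>S T. special S \<and> finite T \<and> (\<forall>F\<in>T. equational F) \<and>
     P = (\<lambda>e. S e \<and> (\<forall>F\<in>T. \<not> F e)))"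

abbreviation nf :: "((nat \<Rightarrow> real) \<Rightarrow> bool) \<Rightarrow> bool" where
  "nf \<equiv> funion piece"

section \<open>Closure of the normal form under Boolean operations and substitution\<close>

lemma special_basic: "asys E \<Longrightarrow> asys G \<Longrightarrow> special (basic E G)"
  unfolding special_def by (intro exI[of _ "{}"] exI[of _ E] exI[of _ G]) (simp add: qex_empty)

lemma special_True: "special (\<lambda>_. True)"
  using special_basic[OF asys_empty asys_empty] by (simp add: basic_def[abs_def])

lemma special_piece: "special S \<Longrightarrow> piece S"
  unfolding piece_def by (intro exI[of _ S] exI[of _ "{}"]) simp

lemma special_nf: "special S \<Longrightarrow> nf S"
  by (intro funion_base special_piece)

lemma piece_True: "piece (\<lambda>_. True)"
  by (rule special_piece[OF special_True])

lemma not_equational_nf: "equational F \<Longrightarrow> nf (\<lambda>e. \<not> F e)"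
  by (rule funion_base, unfold piece_def)
     (intro exI[of _ "\<lambda>_. True"] exI[of _ "{F}"], simp add: special_True)

lemma piece_conj:
  assumes "piece P" "piece Q"
  shows "piece (\<lambda>e. P e \<and> Q e)"
proof -
  obtain S T S' T' where "special S" "finite T" "\<forall>F\<in>T. equational F" "P = (\<lambda>e. S e \<and> (\<forall>F\<in>T. \<not> F e))"
     "special S'" "finite T'" "\<forall>F\<in>T'. equational F" "Q = (\<lambda>e. S' e \<and> (\<forall>F\<in>T'. \<not> F e))"
    using assms unfolding piece_def by blast
  then show ?thesis unfolding piece_def
    by (intro exI[of _ "\<lambda>e. S e \<and> S' e"] exI[of _ "T \<union> T'"]) (auto simp: special_conj)
qed

lemma nf_conj: "nf P \<Longrightarrow> nf Q \<Longrightarrow> nf (\<lambda>e. P e \<and> Q e)"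
  by (rule funion_conj[of piece]) (rule piece_conj)

lemma nf_Ball: "finite A \<Longrightarrow> (\<And>a. a \<in> A \<Longrightarrow> nf (P a)) \<Longrightarrow> nf (\<lambda>e. \<forall>a\<in>A. P a e)"
proof (induction A rule: finite_induct)
  case (insert a A)
  then show ?case using nf_conj[of "P a" "\<lambda>e. \<forall>a\<in>A. P a e"] by simp
qed (simp add: special_nf special_True)

text \<open>Once the equations determine the witness, \<open>S\<close> fails either because the
  equations have no solution of the required kind, or because their unique solution violates some
  inequality. The second case is existential again, since violation means \<open>h = 0\<close> or
  \<open>- h > 0\<close>.\<close>

lemma not_special_nf:
  assumes "special S"
  shows "nf (\<lambda>e. \<not> S e)"
proof -
  obtain J E G where J: "finite J" and E: "asys E" and G: "asys G" and u: "uniq J E"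
    and S: "S = qex J (basic E G)"
    using assms special_uniq unfolding special_def by metis
  have "(\<lambda>e. \<not> S e) = (\<lambda>e. \<not> qex J (basic E {}) e \<or>
     (\<exists>h\<in>G. qex J (basic (insert h E) {}) e \<or> qex J (basic E {\<lambda>e. - h e}) e))"
  proof (intro ext iffI)
    fix e assume n: "\<not> S e"
    show "\<not> qex J (basic E {}) e \<or>
      (\<exists>h\<in>G. qex J (basic (insert h E) {}) e \<or> qex J (basic E {\<lambda>e. - h e}) e)"
    proof (cases "qex J (basic E {}) e")
      case True
      then obtain e1 where e1: "\<And>i. i \<notin> J \<Longrightarrow> e1 i = e i" "\<And>i. i \<in> J \<Longrightarrow> e1 i \<in> \<rat>" "basic E {} e1"
        by (elim qexE) blast
      have "\<not> basic E G e1" using n qexI[of J e1 e "basic E G"] e1(1,2) unfolding S by blast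
      then obtain h where h: "h \<in> G" "h e1 \<le> 0" using e1(3) unfolding basic_def by force
      have "basic (insert h E) {} e1 \<or> basic E {\<lambda>e. - h e} e1"
        using h(2) e1(3) by (auto simp: basic_def)
      then show ?thesis using h(1) qexI[of J e1 e, OF e1(1,2)] by blast
    qed simp
  next
    fix e assume n: "\<not> qex J (basic E {}) e \<or>
      (\<exists>h\<in>G. qex J (basic (insert h E) {}) e \<or> qex J (basic E {\<lambda>e. - h e}) e)"
    show "\<not> S e"
    proof
      assume "S e"
      then obtain e1 where e1: "\<And>i. i \<notin> J \<Longrightarrow> e1 i = e i" "\<And>i. i \<in> J \<Longrightarrow> e1 i \<in> \<rat>" "basic E G e1"
        unfolding S by (elim qexE) blast
      have "qex J (basic E {}) e" by (rule qexI[of _ e1]) (use e1 in \<open>auto simp: basic_def\<close>)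
      then obtain h where h: "h \<in> G" "qex J (basic (insert h E) {}) e \<or> qex J (basic E {\<lambda>e. - h e}) e"
        using n by blast
      then obtain e2 where e2: "\<And>i. i \<notin> J \<Longrightarrow> e2 i = e i" "\<And>i. i \<in> J \<Longrightarrow> e2 i \<in> \<rat>"
        "\<forall>g\<in>E. g e2 = 0" "h e2 \<le> 0"
      proof -
        from h(2) have "qex J (\<lambda>e. (\<forall>g\<in>E. g e = 0) \<and> h e \<le> 0) e"
          by (auto simp: qex_def basic_def intro: less_imp_le)
        then show thesis using that by (elim qexE) blast
      qed
      have "e1 = e2" using u[unfolded uniq_def, rule_format, of e1 e2] e1 e2 unfolding basic_def by auto
      then show False using e1(3) e2(4) h(1) unfolding basic_def by force
    qed
  qed
  moreover have "equational (qex J (basic E {}))" using J E unfolding equational_def by blast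
  moreover have "special (qex J (basic (insert h E) {}))" "special (qex J (basic E {\<lambda>e. - h e}))"
    if "h \<in> G" for h
    by (intro qex_special special_basic J E asys_insert asys_empty aff_uminus asysD[OF G that])+
  ultimately show ?thesis
    by (simp only:) (intro funion_disj not_equational_nf funion_Bex asys_finite[OF G] special_nf; assumption)
qed

lemma not_piece_nf:
  assumes "piece P"
  shows "nf (\<lambda>e. \<not> P e)"
proof -
  obtain S T where P: "special S" "finite T" "\<forall>F\<in>T. equational F" "P = (\<lambda>e. S e \<and> (\<forall>F\<in>T. \<not> F e))"
    using assms unfolding piece_def by blast
  have "nf (\<lambda>e. \<not> S e \<or> (\<exists>F\<in>T. F e))"
    using P(1-3) by (intro funion_disj not_special_nf funion_Bex) (auto intro: special_nf equational_special)
  then show ?thesis unfolding P(4) by simp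
qed

lemma nf_not: "nf P \<Longrightarrow> nf (\<lambda>e. \<not> P e)"
  by (rule funion_not[of piece]) (rule piece_conj piece_True not_piece_nf; assumption)+

lemma piece_subst:
  assumes "piece P" "\<And>i. aff (\<lambda>e. s e i)"
  shows "piece (\<lambda>e. P (s e))"
proof -
  obtain S T where P: "special S" "finite T" "\<forall>F\<in>T. equational F" "P = (\<lambda>e. S e \<and> (\<forall>F\<in>T. \<not> F e))"
    using assms(1) unfolding piece_def by blast
  then show ?thesis unfolding piece_def
    by (intro exI[of _ "\<lambda>e. S (s e)"] exI[of _ "(\<lambda>F e. F (s e)) ` T"])
       (auto intro: special_subst equational_subst assms(2))
qed

lemma nf_subst: "nf P \<Longrightarrow> (\<And>i. aff (\<lambda>e. s e i)) \<Longrightarrow> nf (\<lambda>e. P (s e))"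
  by (rule funion_bind[where f = "\<lambda>P e. P (s e)" and C = piece]) (auto intro: funion_base piece_subst)

end

section \<open>Elimination of rational and real quantifiers\<close>

context real_subfield begin

section \<open>Dichotomies along rational lines\<close>

lemma qex_dichotomy:
  assumes "asys E"
  shows "(\<exists>w. (\<forall>i. i \<notin> J \<longrightarrow> w i = v i) \<and> (\<forall>i\<in>J. w i \<in> \<rat>) \<and> (\<forall>g\<in>E. lin g w = 0)) \<or>
    (\<forall>e. \<forall>s\<in>\<rat>. \<forall>t\<in>\<rat>. qex J (basic E {}) (\<lambda>i. e i + s * v i) \<longrightarrow>
       qex J (basic E {}) (\<lambda>i. e i + t * v i) \<longrightarrow> s = t)"
proof (rule disjCI)
  assume "\<not> (\<forall>e. \<forall>s\<in>\<rat>. \<forall>t\<in>\<rat>. qex J (basic E {}) (\<lambda>i. e i + s * v i) \<longrightarrow>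
       qex J (basic E {}) (\<lambda>i. e i + t * v i) \<longrightarrow> s = t)"
  then obtain e s t where st: "s \<in> \<rat>" "t \<in> \<rat>" "s \<noteq> t"
    and q: "qex J (basic E {}) (\<lambda>i. e i + s * v i)" "qex J (basic E {}) (\<lambda>i. e i + t * v i)"
    by blast
  from q(1) obtain a where a: "\<And>i. i \<notin> J \<Longrightarrow> a i = e i + s * v i" "\<And>i. i \<in> J \<Longrightarrow> a i \<in> \<rat>" "basic E {} a"
    by (elim qexE) blast
  from q(2) obtain b where b: "\<And>i. i \<notin> J \<Longrightarrow> b i = e i + t * v i" "\<And>i. i \<in> J \<Longrightarrow> b i \<in> \<rat>" "basic E {} b"
    by (elim qexE) blast
  \<comment> \<open>The difference quotient of the two witnesses agrees with \<open>v\<close>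
    outside \<open>J\<close>, is rational on \<open>J\<close> because \<open>s\<close> and
    \<open>t\<close> are, and is annihilated by the linear parts.\<close>
  define w where "w i = (b i - a i) / (t - s)" for i
  have "w i = v i" if "i \<notin> J" for i
  proof -
    have "b i - a i = (t - s) * v i" using a(1)[OF that] b(1)[OF that] by (simp add: left_diff_distrib)
    then show ?thesis using st(3) by (simp add: w_def)
  qed
  moreover have "w i \<in> \<rat>" if "i \<in> J" for i using a(2)[OF that] b(2)[OF that] st by (simp add: w_def)
  moreover have "lin g w = 0" if "g \<in> E" for g
  proof -
    have "b = (\<lambda>i. a i + (t - s) * w i)" using st(3) by (auto simp: w_def)
    then have "g b = g a + (t - s) * lin g w"
      using aff_shift[OF asysD[OF assms that], of a "t - s" w] by simp
    moreover have "g a = 0" "g b = 0" using a(3) b(3) that unfolding basic_def by blast+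
    ultimately show ?thesis using st(3) by simp
  qed
  ultimately show "\<exists>w. (\<forall>i. i \<notin> J \<longrightarrow> w i = v i) \<and> (\<forall>i\<in>J. w i \<in> \<rat>) \<and> (\<forall>g\<in>E. lin g w = 0)"
    by blast
qed

text \<open>The witness moves along \<open>w\<close> while the point moves along \<open>v\<close>.
  Only the inequalities bound the step, hence the alternative \<open>G = {}\<close>, which gives a
  global statement for equational conditions.\<close>

lemma qex_shift:
  assumes "asys E" "asys G" "\<forall>i. i \<notin> J \<longrightarrow> w i = v i" "\<forall>i\<in>J. w i \<in> \<rat>" "\<forall>g\<in>E. lin g w = 0"
    "qex J (basic E G) e"
  shows "\<exists>d>0. \<forall>t\<in>\<rat>. \<bar>t\<bar> < d \<or> G = {} \<longrightarrow> qex J (basic E G) (\<lambda>i. e i + t * v i)"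
proof -
  from assms(6) obtain a where a: "\<And>i. i \<notin> J \<Longrightarrow> a i = e i" "\<And>i. i \<in> J \<Longrightarrow> a i \<in> \<rat>" "basic E G a"
    by (elim qexE) blast
  have "\<forall>h\<in>G. 0 < h a" using a(3) by (simp add: basic_def)
  from asys_open[OF assms(2) this, of w] obtain d where
    d: "0 < d" "\<And>t. \<bar>t\<bar> < d \<Longrightarrow> \<forall>h\<in>G. 0 < h (\<lambda>i. a i + t * w i)" by blast
  have "qex J (basic E G) (\<lambda>i. e i + t * v i)" if "t \<in> \<rat>" "\<bar>t\<bar> < d \<or> G = {}" for t
  proof (rule qexI[of _ "\<lambda>i. a i + t * w i"])
    have "g (\<lambda>i. a i + t * w i) = 0" if "g \<in> E" for g
      using aff_shift[OF asysD[OF assms(1) that], of a t w] a(3) assms(5) that by (simp add: basic_def)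
    then show "basic E G (\<lambda>i. a i + t * w i)" using d(2)[of t] that by (auto simp: basic_def)
  qed (use a assms(3,4) that in auto)
  then show ?thesis using d(1) by blast
qed

text \<open>If \<open>v\<close> lifts to a direction \<open>w\<close> that preserves the equations,
  shifting by \<open>t\<close> and back by \<open>- t\<close> gives invariance.\<close>

lemma equational_dichotomy:
  assumes "equational F"
  shows "(\<forall>e. \<forall>t\<in>\<rat>. F (\<lambda>i. e i + t * v i) = F e) \<or>
    (\<forall>e. \<forall>s\<in>\<rat>. \<forall>t\<in>\<rat>. F (\<lambda>i. e i + s * v i) \<longrightarrow> F (\<lambda>i. e i + t * v i) \<longrightarrow> s = t)"
proof -
  obtain J E where F: "finite J" "asys E" "F = qex J (basic E {})"
    using assms unfolding equational_def by blast
  show ?thesis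
  proof (rule disjE[OF qex_dichotomy[OF F(2), of J v]])
    assume "\<exists>w. (\<forall>i. i \<notin> J \<longrightarrow> w i = v i) \<and> (\<forall>i\<in>J. w i \<in> \<rat>) \<and> (\<forall>g\<in>E. lin g w = 0)"
    then obtain w where w: "\<forall>i. i \<notin> J \<longrightarrow> w i = v i" "\<forall>i\<in>J. w i \<in> \<rat>" "\<forall>g\<in>E. lin g w = 0" by blast
    have 1: "F (\<lambda>i. e i + t * v i)" if "F e" "t \<in> \<rat>" for e t
      using qex_shift[OF F(2) asys_empty w, of e] that F(3) by blast
    have "F (\<lambda>i. e i + t * v i) = F e" if "t \<in> \<rat>" for e t
      using 1[OF _ that, of e] 1[of "\<lambda>i. e i + t * v i" "- t"] that by auto
    then show ?thesis by blast
  qed (auto simp: F(3))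
qed

text \<open>With inequalities present, invariance weakens to persistence under small rational
  shifts. The other alternative is inherited from the equations alone.\<close>

lemma special_dichotomy:
  assumes "special S"
  shows "(\<forall>e. S e \<longrightarrow> (\<exists>d>0. \<forall>t\<in>\<rat>. \<bar>t\<bar> < d \<longrightarrow> S (\<lambda>i. e i + t * v i))) \<or>
    (\<forall>e. \<forall>s\<in>\<rat>. \<forall>t\<in>\<rat>. S (\<lambda>i. e i + s * v i) \<longrightarrow> S (\<lambda>i. e i + t * v i) \<longrightarrow> s = t)"
proof -
  obtain J E G where S: "finite J" "asys E" "asys G" "S = qex J (basic E G)"
    using assms unfolding special_def by blast
  have SE: "qex J (basic E {}) e" if "S e" for e
    using that unfolding S(4) qex_def basic_def by blast
  show ?thesis
  proof (rule disjE[OF qex_dichotomy[OF S(2), of J v]])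
    assume "\<exists>w. (\<forall>i. i \<notin> J \<longrightarrow> w i = v i) \<and> (\<forall>i\<in>J. w i \<in> \<rat>) \<and> (\<forall>g\<in>E. lin g w = 0)"
    then obtain w where w: "\<forall>i. i \<notin> J \<longrightarrow> w i = v i" "\<forall>i\<in>J. w i \<in> \<rat>" "\<forall>g\<in>E. lin g w = 0" by blast
    have "\<exists>d>0. \<forall>t\<in>\<rat>. \<bar>t\<bar> < d \<longrightarrow> S (\<lambda>i. e i + t * v i)" if "S e" for e
      using qex_shift[OF S(2,3) w, of e] that S(4) by blast
    then show ?thesis by blast
  next
    assume "\<forall>e. \<forall>s\<in>\<rat>. \<forall>t\<in>\<rat>. qex J (basic E {}) (\<lambda>i. e i + s * v i) \<longrightarrow>
       qex J (basic E {}) (\<lambda>i. e i + t * v i) \<longrightarrow> s = t"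
    then show ?thesis using SE by blast
  qed
qed

section \<open>Elimination of rational quantifiers\<close>

lemma ex_rat_special: "special S \<Longrightarrow> special (\<lambda>e. \<exists>r\<in>\<rat>. S (e(j := r)))"
  using qex_special[of S "{j}"] by (simp add: qex_single[abs_def])

text \<open>Either \<open>S\<close> holds for at most one rational value, or it persists under small
  rational shifts. In the second case the non-invariant negated conditions can be dodged by such a
  shift, and the invariant ones leave the scope of the quantifier.\<close>

lemma piece_ex_rat:
  assumes "piece P"
  shows "nf (\<lambda>e. \<exists>r\<in>\<rat>. P (e(j := r)))"
proof -
  obtain S T where S: "special S" and T: "finite T" "\<And>F. F \<in> T \<Longrightarrow> equational F"
    and P: "P = (\<lambda>e. S e \<and> (\<forall>F\<in>T. \<not> F e))"
    using assms unfolding piece_def by blast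
  define v where "v i = (if i = j then 1 else 0 :: real)" for i
  have upd: "(e(j := r)) = (\<lambda>i. (e(j := s)) i + (r - s) * v i)" for e r s by (auto simp: v_def)
  have upd0: "(e(j := r)) = (\<lambda>i. (e(j := 0)) i + r * v i)" for e r by (auto simp: v_def)
  show ?thesis
  proof (rule disjE[OF special_dichotomy[OF S, of v]])
    assume *: "\<forall>e. \<forall>s\<in>\<rat>. \<forall>t\<in>\<rat>. S (\<lambda>i. e i + s * v i) \<longrightarrow> S (\<lambda>i. e i + t * v i) \<longrightarrow> s = t"
    have u: "s = t" if "s \<in> \<rat>" "t \<in> \<rat>" "S (e(j := s))" "S (e(j := t))" for s t e
      using *[rule_format, of s t "e(j := 0)", folded upd0] that by blast
    \<comment> \<open>Since at most one rational satisfies \<open>S\<close>, avoiding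
      \<open>F\<close> at that value means that no rational satisfies both \<open>S\<close> and
      \<open>F\<close>.\<close>
    have "(\<lambda>e. \<exists>r\<in>\<rat>. P (e(j := r))) = (\<lambda>e. (\<exists>r\<in>\<rat>. S (e(j := r))) \<and>
      (\<forall>F\<in>T. \<not> (\<exists>r\<in>\<rat>. S (e(j := r)) \<and> F (e(j := r)))))"
    proof (intro ext iffI)
      fix e assume "\<exists>r\<in>\<rat>. P (e(j := r))"
      then obtain r where "r \<in> \<rat>" "S (e(j := r))" "\<forall>F\<in>T. \<not> F (e(j := r))" unfolding P by blast
      then show "(\<exists>r\<in>\<rat>. S (e(j := r))) \<and> (\<forall>F\<in>T. \<not> (\<exists>r\<in>\<rat>. S (e(j := r)) \<and> F (e(j := r))))"
        using u by metis
    qed (auto simp: P)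
    moreover have "special (\<lambda>e. \<exists>r\<in>\<rat>. S (e(j := r)) \<and> F (e(j := r)))" if "F \<in> T" for F
      by (rule ex_rat_special[OF special_conj[OF S equational_special[OF T(2)[OF that]]]])
    ultimately show ?thesis using ex_rat_special[OF S, of j] T(1)
      by (simp only:) (intro nf_conj nf_Ball not_special_nf special_nf; assumption?; blast)
  next
    assume *: "\<forall>e. S e \<longrightarrow> (\<exists>d>0. \<forall>t\<in>\<rat>. \<bar>t\<bar> < d \<longrightarrow> S (\<lambda>i. e i + t * v i))"
    define T0 where "T0 = {F \<in> T. \<forall>e. \<forall>t\<in>\<rat>. F (\<lambda>i. e i + t * v i) = F e}"
    have T0: "F (e(j := r)) \<longleftrightarrow> F (e(j := s))" if "F \<in> T0" "r \<in> \<rat>" "s \<in> \<rat>" for F e r s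
    proof -
      have "\<forall>e. \<forall>t\<in>\<rat>. F (\<lambda>i. e i + t * v i) = F e" using that(1) unfolding T0_def by blast
      from this[rule_format, OF Rats_diff[OF that(2,3)], of "e(j := s)", folded upd] show ?thesis .
    qed
    \<comment> \<open>The invariant conditions are tested at rational values rather than at
      \<open>e\<close> itself: \<open>e j\<close> may be irrational, and invariance concerns
      rational shifts.\<close>
    have "(\<lambda>e. \<exists>r\<in>\<rat>. P (e(j := r))) = (\<lambda>e. (\<exists>r\<in>\<rat>. S (e(j := r))) \<and>
      (\<forall>F\<in>T0. \<not> (\<exists>r\<in>\<rat>. F (e(j := r)))))"
    proof (intro ext iffI)
      fix e assume "\<exists>r\<in>\<rat>. P (e(j := r))"
      then obtain r where "r \<in> \<rat>" "S (e(j := r))" "\<forall>F\<in>T. \<not> F (e(j := r))" unfolding P by blast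
      moreover have "T0 \<subseteq> T" by (auto simp: T0_def)
      ultimately show "(\<exists>r\<in>\<rat>. S (e(j := r))) \<and> (\<forall>F\<in>T0. \<not> (\<exists>r\<in>\<rat>. F (e(j := r))))"
        using T0 by (metis subsetD)
    next
      fix e assume "(\<exists>r\<in>\<rat>. S (e(j := r))) \<and> (\<forall>F\<in>T0. \<not> (\<exists>r\<in>\<rat>. F (e(j := r))))"
      then obtain r where r: "r \<in> \<rat>" "S (e(j := r))" "\<And>F q. F \<in> T0 \<Longrightarrow> q \<in> \<rat> \<Longrightarrow> \<not> F (e(j := q))"
        by blast
      obtain d where d: "0 < d" "\<And>t. t \<in> \<rat> \<Longrightarrow> \<bar>t\<bar> < d \<Longrightarrow> S (\<lambda>i. (e(j := r)) i + t * v i)"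
        using * r(2) by blast
      have "\<exists>t\<in>\<rat>. 0 < t \<and> t < d \<and> (\<forall>F\<in>T - T0. \<not> F (\<lambda>i. (e(j := r)) i + t * v i))"
      proof (rule ex_small_rational_avoiding)
        fix F s t assume "F \<in> T - T0" "s \<in> \<rat>" "t \<in> \<rat>"
          "F (\<lambda>i. (e(j := r)) i + s * v i)" "F (\<lambda>i. (e(j := r)) i + t * v i)"
        then show "s = t" using equational_dichotomy[OF T(2), of F v] unfolding T0_def by blast
      qed (use T d in auto)
      then obtain t where t: "t \<in> \<rat>" "0 < t" "t < d" "\<And>F. F \<in> T - T0 \<Longrightarrow> \<not> F (\<lambda>i. (e(j := r)) i + t * v i)"
        by blast
      have e: "(\<lambda>i. (e(j := r)) i + t * v i) = e(j := r + t)" by (auto simp: v_def)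
      have "S (e(j := r + t))" using d(2)[of t] t(1-3) e by simp
      moreover have "\<not> F (e(j := r + t))" if "F \<in> T" for F
        using t(4)[of F, unfolded e] r(3)[of F "r + t"] r(1) t(1) that by (cases "F \<in> T0") auto
      ultimately show "\<exists>r\<in>\<rat>. P (e(j := r))" unfolding P using r(1) t(1) by (intro bexI[of _ "r + t"]) auto
    qed
    moreover have "finite T0" "F \<in> T0 \<Longrightarrow> special F" for F
      using T equational_special by (auto simp: T0_def)
    ultimately show ?thesis using ex_rat_special[OF S, of j] ex_rat_special[where j = j]
      by (simp only:) (intro nf_conj nf_Ball not_special_nf special_nf; assumption?; blast)
  qed
qed

lemma nf_ex_rat: "nf P \<Longrightarrow> nf (\<lambda>e. \<exists>r\<in>\<rat>. P (e(j := r)))"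
  by (rule funion_bind[where f = "\<lambda>P e. \<exists>r\<in>\<rat>. P (e(j := r))" and C = piece])
     (auto simp: fun_eq_iff intro: piece_ex_rat)

lemma nf_qex: "finite J \<Longrightarrow> nf P \<Longrightarrow> nf (qex J P)"
proof (induction J rule: finite_induct)
  case (insert j J)
  have "qex (insert j J) P = (\<lambda>e. \<exists>r\<in>\<rat>. qex J P (e(j := r)))"
    using qex_qex[of "{j}" J P] by (simp add: qex_single[abs_def])
  then show ?case using nf_ex_rat[of "qex J P" j] insert by simp
qed (simp add: qex_empty)

section \<open>Elimination of real quantifiers\<close>

lemma qex_upd: "j \<notin> J \<Longrightarrow> qex J P (e(j := x)) \<longleftrightarrow> qex J (\<lambda>e. P (e(j := x))) e"
proof
  assume j: "j \<notin> J" and "qex J P (e(j := x))"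
  then obtain a where a: "\<And>i. i \<notin> J \<Longrightarrow> a i = (e(j := x)) i" "\<And>i. i \<in> J \<Longrightarrow> a i \<in> \<rat>" "P a"
    by (elim qexE) blast
  then have "(a(j := e j))(j := x) = a" using a(1)[OF j] by auto
  then show "qex J (\<lambda>e. P (e(j := x))) e"
    using a j by (intro qexI[of _ "a(j := e j)"]) (auto split: if_splits)
next
  assume j: "j \<notin> J" and "qex J (\<lambda>e. P (e(j := x))) e"
  then obtain a where a: "\<And>i. i \<notin> J \<Longrightarrow> a i = e i" "\<And>i. i \<in> J \<Longrightarrow> a i \<in> \<rat>" "P (a(j := x))"
    by (elim qexE) blast
  then show "qex J P (e(j := x))" using j by (intro qexI[of _ "a(j := x)"]) auto
qed

text \<open>If some equation involves \<open>x\<close>, then \<open>x\<close> is a function of the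
  witness, and there are only countably many rational witnesses over a given point. Otherwise
  \<open>x\<close> does not matter. The block is first renamed so as not to bind
  \<open>j\<close>.\<close>

lemma equational_line:
  assumes "equational F"
  shows "(\<forall>e x y. F (e(j := x)) = F (e(j := y))) \<or> (\<forall>e. countable {x. F (e(j := x))})"
proof -
  obtain J0 E0 where F0: "finite J0" "asys E0" "F = qex J0 (basic E0 {})"
    using assms unfolding equational_def by blast
  obtain J' t where t: "finite J'" "J' \<inter> {j} = {}" "\<And>i. aff (\<lambda>e. t e i)"
    "(\<lambda>e. qex J0 (basic E0 {}) e) = qex J' (basic (pull t E0) (pull t {}))"
    using special_subst_fresh[of J0 E0 "{}" "{j}" "\<lambda>e. e"] F0 asys_empty aff_var by (metis finite.emptyI finite_insert)
  let ?E = "pull t E0"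
  have Fq: "F = qex J' (basic ?E {})" using t(4) F0(3) by (simp add: pull_def)
  have E: "asys ?E" by (intro asys_pull F0 t)
  have j: "j \<notin> J'" using t(2) by blast
  show ?thesis
  proof (cases "\<exists>g\<in>?E. \<exists>e x. g (e(j := x)) \<noteq> g (e(j := 0))")
    case True
    then obtain g e0 x0 where g: "g \<in> ?E" "g (e0(j := x0)) \<noteq> g (e0(j := 0))" by blast
    obtain u where u: "aff u" "\<And>e x. g (e(j := x)) = 0 \<longleftrightarrow> x = u e"
      using solve_for_variable[OF asysD[OF E g(1)] g(2)] by blast
    have "{x. F (e(j := x))} \<subseteq> u ` {e'. (\<forall>i. i \<notin> J' \<longrightarrow> e' i = e i) \<and> (\<forall>i\<in>J'. e' i \<in> \<rat>)}" for e
    proof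
      fix x assume "x \<in> {x. F (e(j := x))}"
      then have "qex J' (\<lambda>e. basic ?E {} (e(j := x))) e" using qex_upd[OF j] Fq by simp
      then obtain a where a: "\<And>i. i \<notin> J' \<Longrightarrow> a i = e i" "\<And>i. i \<in> J' \<Longrightarrow> a i \<in> \<rat>" "basic ?E {} (a(j := x))"
        by (elim qexE) blast
      have "x = u a" using a(3) g(1) u(2)[of a x] unfolding basic_def by blast
      then show "x \<in> u ` {e'. (\<forall>i. i \<notin> J' \<longrightarrow> e' i = e i) \<and> (\<forall>i\<in>J'. e' i \<in> \<rat>)}" using a by blast
    qed
    then show ?thesis
      using countable_subset countable_image countable_rational_modifications[OF t(1)] by meson
  next
    case False
    then have Ej: "g (e(j := x)) = g (e(j := y))" if "g \<in> ?E" for g e x y using that by metis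
    have all: "(\<forall>g\<in>?E. g (e(j := x)) = 0) = (\<forall>g\<in>?E. g (e(j := y)) = 0)" for e x y
      by (rule ball_cong[OF refl], subst Ej[of _ e x y]) (assumption, rule refl)
    have eq: "(\<lambda>e. basic ?E {} (e(j := x))) = (\<lambda>e. basic ?E {} (e(j := y)))" for x y
      unfolding basic_def by (rule ext) (simp add: all[of _ x y])
    have "F (e(j := x)) = F (e(j := y))" for e x y
      unfolding Fq qex_upd[OF j] eq[of x y] ..
    then show ?thesis by blast
  qed
qed

text \<open>An equation that involves \<open>x\<close> determines it and is substituted. Otherwise
  the solutions \<open>x\<close> contain an interval around each of them, and an interval is not
  exhausted by the countably many values excluded by non-invariant conditions. The invariant ones do
  not see \<open>x\<close> and move outside.\<close>

lemma basic_avoid_ex: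
  assumes E: "asys E" and G: "asys G" and T: "finite T" "\<And>F. F \<in> T \<Longrightarrow> equational F"
  shows "nf (\<lambda>e. \<exists>x. basic E G (e(j := x)) \<and> (\<forall>F\<in>T. \<not> F (e(j := x))))"
proof (cases "\<exists>g\<in>E. \<exists>e x. g (e(j := x)) \<noteq> g (e(j := 0))")
  case True
  then obtain g e0 x0 where g: "g \<in> E" "g (e0(j := x0)) \<noteq> g (e0(j := 0))" by blast
  obtain u where u: "aff u" "\<And>e x. g (e(j := x)) = 0 \<longleftrightarrow> x = u e"
    using solve_for_variable[OF asysD[OF E g(1)] g(2)] by blast
  have "x = u e" if "basic E G (e(j := x))" for e x
    using that g(1) u(2)[of e x] by (simp add: basic_def)
  then have "(\<lambda>e. \<exists>x. basic E G (e(j := x)) \<and> (\<forall>F\<in>T. \<not> F (e(j := x)))) =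
    (\<lambda>e. basic E G (e(j := u e)) \<and> (\<forall>F\<in>T. \<not> F (e(j := u e))))"
    by (intro ext) blast
  moreover have "piece (\<lambda>e. basic E G e \<and> (\<forall>F\<in>T. \<not> F e))"
    unfolding piece_def using T special_basic[OF E G] by blast
  from piece_subst[OF this, of "\<lambda>e. e(j := u e)", OF aff_upd[OF u(1)]]
  have "piece (\<lambda>e. basic E G (e(j := u e)) \<and> (\<forall>F\<in>T. \<not> F (e(j := u e))))" .
  ultimately show ?thesis by (simp only: funion_base)
next
  case False
  then have Ej: "g (e(j := x)) = g (e(j := y))" if "g \<in> E" for g e x y using that by metis
  define T0 where "T0 = {F \<in> T. \<forall>e x y. F (e(j := x)) = F (e(j := y))}"
  have T0: "finite T0" "\<And>F. F \<in> T0 \<Longrightarrow> equational F" using T by (auto simp: T0_def)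
  obtain E' G' where E': "asys E'" "asys G'" "\<And>e. (\<exists>x. basic E G (e(j := x))) \<longleftrightarrow> basic E' G' e"
    using basic_ex[OF E G] by blast
  have "(\<lambda>e. \<exists>x. basic E G (e(j := x)) \<and> (\<forall>F\<in>T. \<not> F (e(j := x)))) =
    (\<lambda>e. basic E' G' e \<and> (\<forall>F\<in>T0. \<not> F e))"
  proof (intro ext iffI)
    fix e assume "\<exists>x. basic E G (e(j := x)) \<and> (\<forall>F\<in>T. \<not> F (e(j := x)))"
    then obtain x where x: "basic E G (e(j := x))" "\<forall>F\<in>T. \<not> F (e(j := x))" by blast
    have "\<not> F e" if "F \<in> T0" for F
    proof -
      have "F (e(j := x)) = F (e(j := e j))" "\<not> F (e(j := x))" using that x(2) unfolding T0_def by blast+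
      then show ?thesis by simp
    qed
    then show "basic E' G' e \<and> (\<forall>F\<in>T0. \<not> F e)" using x(1) E'(3) by blast
  next
    fix e assume *: "basic E' G' e \<and> (\<forall>F\<in>T0. \<not> F e)"
    then obtain x where x: "basic E G (e(j := x))" using E'(3) by blast
    define v where "v i = (if i = j then 1 else 0 :: real)" for i
    have "\<forall>h\<in>G. 0 < h (e(j := x))" using x by (simp add: basic_def)
    from asys_open[OF G this, of v] obtain d where
      d: "0 < d" "\<And>t. \<bar>t\<bar> < d \<Longrightarrow> \<forall>h\<in>G. 0 < h (\<lambda>i. (e(j := x)) i + t * v i)" by blast
    have line: "(\<lambda>i. (e(j := x)) i + (y - x) * v i) = e(j := y)" for y by (auto simp: v_def)
    have ok: "basic E G (e(j := y))" if "y \<in> {x<..<x + d}" for y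
    proof -
      have "g (e(j := y)) = 0" if "g \<in> E" for g
        using Ej[OF that, of e y x] x that unfolding basic_def by metis
      then show ?thesis using d(2)[of "y - x"] that unfolding line basic_def by simp
    qed
    have "countable {y. F (e(j := y))}" if "F \<in> T - T0" for F
      using equational_line[OF T(2), of F j] that unfolding T0_def by blast
    moreover have "countable (T - T0)" using T(1) by (intro countable_finite) simp
    ultimately have "countable (\<Union>F\<in>T - T0. {y. F (e(j := y))})" by blast
    moreover have "uncountable {x<..<x + d}" using d(1) by (simp add: uncountable_open_interval)
    ultimately obtain y where y: "y \<in> {x<..<x + d}" "y \<notin> (\<Union>F\<in>T - T0. {y. F (e(j := y))})"
      by (meson countable_subset subsetI)
    have "\<not> F (e(j := y))" if "F \<in> T" for F
    proof (cases "F \<in> T0")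
      case True
      then have "F (e(j := y)) = F (e(j := e j))" "\<not> F e" using * unfolding T0_def by blast+
      then show ?thesis by simp
    qed (use y(2) that in blast)
    then show "\<exists>x. basic E G (e(j := x)) \<and> (\<forall>F\<in>T. \<not> F (e(j := x)))" using ok[OF y(1)] by blast
  qed
  moreover have "piece (\<lambda>e. basic E' G' e \<and> (\<forall>F\<in>T0. \<not> F e))"
    unfolding piece_def using T0 special_basic[OF E'(1,2)] by blast
  ultimately show ?thesis by (simp only: funion_base)
qed

text \<open>The rational block is chosen off \<open>j\<close> and off the supports of the negated
  conditions, so that it can be exchanged with the real quantifier. The real variable is then
  eliminated from a matrix without rational quantifiers in its positive part, and the block by
  \<open>nf_qex\<close>.\<close>

lemma piece_ex:
  assumes "piece P"
  shows "nf (\<lambda>e. \<exists>x. P (e(j := x)))"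
proof -
  obtain S T where S: "special S" and T: "finite T" "\<And>F. F \<in> T \<Longrightarrow> equational F"
    and P: "P = (\<lambda>e. S e \<and> (\<forall>F\<in>T. \<not> F e))"
    using assms unfolding piece_def by blast
  have "\<forall>F\<in>T. \<exists>Z. supp Z F" using T(2) equational_special special_supp by blast
  then obtain Z where Z: "\<And>F. F \<in> T \<Longrightarrow> supp (Z F) F" by metis
  have "finite (insert j (\<Union>F\<in>T. Z F))" using T(1) Z by (auto simp: supp_def)
  then obtain J E G where J: "finite J" "asys E" "asys G" "J \<inter> insert j (\<Union>F\<in>T. Z F) = {}"
    "S = qex J (basic E G)" using special_fresh[OF S] by metis
  have j: "j \<notin> J" using J(4) by blast
  have indep: "F (e(j := x)) = F (e'(j := x))" if "F \<in> T" "\<And>i. i \<notin> J \<Longrightarrow> e i = e' i" for F e e' x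
    by (rule suppD[OF Z[OF that(1)]]) (use that J(4) in auto)
  have "P (e(j := x)) \<longleftrightarrow> qex J (\<lambda>e. basic E G (e(j := x)) \<and> (\<forall>F\<in>T. \<not> F (e(j := x)))) e" for e x
    unfolding P J(5) qex_upd[OF j] by (rule qex_conj) (use indep in blast)
  then have "(\<lambda>e. \<exists>x. P (e(j := x))) =
    qex J (\<lambda>e. \<exists>x. basic E G (e(j := x)) \<and> (\<forall>F\<in>T. \<not> F (e(j := x))))"
    unfolding fun_eq_iff qex_def by blast
  then show ?thesis using nf_qex[OF J(1) basic_avoid_ex[OF J(2,3) T]] by simp
qed

lemma nf_ex: "nf P \<Longrightarrow> nf (\<lambda>e. \<exists>x. P (e(j := x)))"
  by (rule funion_bind[where f = "\<lambda>P e. \<exists>x. P (e(j := x))" and C = piece])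
     (auto simp: fun_eq_iff intro: piece_ex)

end

section \<open>Closures of definable sets\<close>

context real_subfield begin

section \<open>Semilinear predicates, the counterpart without rational quantifiers\<close>

definition linset :: "((nat \<Rightarrow> real) \<Rightarrow> bool) \<Rightarrow> bool" where
  "linset P \<longleftrightarrow> (\<exists>E G. asys E \<and> asys G \<and> P = basic E G)"

abbreviation semilin :: "((nat \<Rightarrow> real) \<Rightarrow> bool) \<Rightarrow> bool" where
  "semilin \<equiv> funion linset"

lemma linset_basic: "asys E \<Longrightarrow> asys G \<Longrightarrow> linset (basic E G)"
  unfolding linset_def by blast

lemma linset_conj: "linset P \<Longrightarrow> linset Q \<Longrightarrow> linset (\<lambda>e. P e \<and> Q e)"
proof -
  assume "linset P" "linset Q"
  then obtain E G E' G' where *: "asys E" "asys G" "asys E'" "asys G'" "P = basic E G" "Q = basic E' G'"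
    unfolding linset_def by blast
  then have "(\<lambda>e. P e \<and> Q e) = basic (E \<union> E') (G \<union> G')" by (simp add: basic_Un[abs_def])
  then show ?thesis using * linset_basic asys_Un by simp
qed

lemma linset_True: "linset (\<lambda>_. True)"
  using linset_basic[OF asys_empty asys_empty] by (simp add: basic_def[abs_def])

lemma linset_eq: "aff g \<Longrightarrow> linset (\<lambda>e. g e = 0)"
  using linset_basic[OF asys_insert[OF _ asys_empty] asys_empty, of g] by (simp add: basic_def[abs_def])

lemma linset_pos: "aff g \<Longrightarrow> linset (\<lambda>e. 0 < g e)"
  using linset_basic[OF asys_empty asys_insert[OF _ asys_empty], of g] by (simp add: basic_def[abs_def])

lemma not_linset:
  assumes "linset P"
  shows "semilin (\<lambda>e. \<not> P e)"
proof -
  obtain E G where E: "asys E" and G: "asys G" and P: "P = basic E G"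
    using assms unfolding linset_def by blast
  have nonzero: "0 < x \<or> 0 < - x \<longleftrightarrow> \<not> x = 0" and nonpos: "x = 0 \<or> 0 < - x \<longleftrightarrow> \<not> 0 < x"
    for x :: real by auto
  have "(\<lambda>e. \<not> P e) = (\<lambda>e. (\<exists>g\<in>E. 0 < g e \<or> 0 < - g e) \<or> (\<exists>h\<in>G. h e = 0 \<or> 0 < - h e))"
    unfolding P basic_def nonzero nonpos by (rule ext) blast
  moreover have "semilin (\<lambda>e. 0 < g e \<or> 0 < - g e)" if "g \<in> E" for g
    by (rule funion_disj[OF funion_base[of linset, OF linset_pos] funion_base[of linset, OF linset_pos]])
       (rule aff_uminus asysD[OF E that])+
  then have "semilin (\<lambda>e. \<exists>g\<in>E. 0 < g e \<or> 0 < - g e)"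
    by (rule funion_Bex[OF asys_finite[OF E]])
  moreover have "semilin (\<lambda>e. h e = 0 \<or> 0 < - h e)" if "h \<in> G" for h
    by (rule funion_disj[OF funion_base[of linset, OF linset_eq] funion_base[of linset, OF linset_pos]])
       (rule aff_uminus asysD[OF G that])+
  then have "semilin (\<lambda>e. \<exists>h\<in>G. h e = 0 \<or> 0 < - h e)"
    by (rule funion_Bex[OF asys_finite[OF G]])
  ultimately show ?thesis by (simp only: funion_disj)
qed

lemma semilin_not: "semilin P \<Longrightarrow> semilin (\<lambda>e. \<not> P e)"
  by (rule funion_not[of linset]) (rule linset_conj linset_True not_linset; assumption)+

lemma semilin_conj: "semilin P \<Longrightarrow> semilin Q \<Longrightarrow> semilin (\<lambda>e. P e \<and> Q e)"
  by (rule funion_conj[of linset]) (rule linset_conj)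

lemma linset_ex:
  assumes "linset P"
  shows "linset (\<lambda>e. \<exists>x. P (e(j := x)))"
proof -
  obtain E G where E: "asys E" and G: "asys G" and P: "P = basic E G"
    using assms unfolding linset_def by blast
  obtain E' G' where E': "asys E'" "asys G'" "\<And>e. (\<exists>x. basic E G (e(j := x))) \<longleftrightarrow> basic E' G' e"
    using basic_ex[OF E G] by blast
  have "(\<lambda>e. \<exists>x. P (e(j := x))) = basic E' G'" unfolding P E'(3) ..
  then show ?thesis using linset_basic[OF E'(1,2)] by simp
qed

lemma semilin_ex: "semilin P \<Longrightarrow> semilin (\<lambda>e. \<exists>x. P (e(j := x)))"
  by (rule funion_bind[where f = "\<lambda>P e. \<exists>x. P (e(j := x))" and C = linset])
     (auto simp: fun_eq_iff intro: funion_base linset_ex)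

lemma semilin_ex_finite:
  "finite Z \<Longrightarrow> semilin P \<Longrightarrow> semilin (\<lambda>e. \<exists>e'. (\<forall>i. i \<notin> Z \<longrightarrow> e' i = e i) \<and> P e')"
proof (induction Z rule: finite_induct)
  case empty
  have "(\<forall>i. i \<notin> {} \<longrightarrow> e' i = e i) \<longleftrightarrow> e' = e" for e e' :: "nat \<Rightarrow> real" by auto
  then show ?case using empty by simp
next
  case (insert j Z)
  have "(\<exists>e'. (\<forall>i. i \<notin> insert j Z \<longrightarrow> e' i = e i) \<and> P e') \<longleftrightarrow>
    (\<exists>x e'. (\<forall>i. i \<notin> Z \<longrightarrow> e' i = (e(j := x)) i) \<and> P e')" for e
  proof
    assume "\<exists>e'. (\<forall>i. i \<notin> insert j Z \<longrightarrow> e' i = e i) \<and> P e'"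
    then obtain e' where e': "\<forall>i. i \<notin> insert j Z \<longrightarrow> e' i = e i" "P e'" by blast
    then have "\<forall>i. i \<notin> Z \<longrightarrow> e' i = (e(j := e' j)) i" by simp
    then show "\<exists>x e'. (\<forall>i. i \<notin> Z \<longrightarrow> e' i = (e(j := x)) i) \<and> P e'" using e'(2) by blast
  next
    assume "\<exists>x e'. (\<forall>i. i \<notin> Z \<longrightarrow> e' i = (e(j := x)) i) \<and> P e'"
    then obtain x e' where "\<forall>i. i \<notin> Z \<longrightarrow> e' i = (e(j := x)) i" "P e'" by blast
    then show "\<exists>e'. (\<forall>i. i \<notin> insert j Z \<longrightarrow> e' i = e i) \<and> P e'" by (intro exI[of _ e']) auto
  qed
  then show ?case using semilin_ex[OF insert.IH[OF insert.prems], of j] by simp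
qed

text \<open>The closure of an affine image of an open polyhedron is described by a first-order
  condition in which \<epsilon> is one more variable, so elimination of real quantifiers
  applies.\<close>

lemma semilin_limit:
  assumes Z: "finite Z" and G: "asys G" and s: "\<And>i. aff (\<lambda>e. s e i)"
  shows "semilin (\<lambda>a. \<forall>\<epsilon>>0. \<exists>e. (\<forall>i. i \<notin> Z \<longrightarrow> e i = 0) \<and> (\<forall>h\<in>G. 0 < h e) \<and>
    (\<forall>i<n. \<bar>s e i - a i\<bar> < \<epsilon>))"
proof -
  \<comment> \<open>Layout of the variables: indices below \<open>n\<close> hold the point
    \<open>a\<close>, index \<open>n\<close> holds \<epsilon>, and \<open>n + 1 + k\<close> holds
    the copy of the quantified coordinate \<open>k\<close>.\<close>
  define t where "t e k = (if k \<in> Z then e (n + 1 + k) else 0 :: real)" for e k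
  have t: "aff (\<lambda>e. t e i)" for i unfolding t_def by (intro aff_If aff_var aff_const)
  define Z' where "Z' = (\<lambda>k. n + 1 + k) ` Z"
  have Z': "finite Z'" "\<And>i. i \<le> n \<Longrightarrow> i \<notin> Z'" using Z by (auto simp: Z'_def)
  define H where "H = pull t G \<union> (\<lambda>i e. e n - (s (t e) i - e i)) ` {..<n} \<union>
    (\<lambda>i e. e n + (s (t e) i - e i)) ` {..<n}"
  have st: "aff (\<lambda>e. s (t e) i)" for i using aff_subst[OF s t] .
  have H: "asys H" unfolding H_def
    by (intro asys_Un asys_pull G t asys_image finite_lessThan aff_add aff_diff aff_var st)
  have Hiff: "(\<forall>h\<in>H. 0 < h e) \<longleftrightarrow> (\<forall>h\<in>G. 0 < h (t e)) \<and> (\<forall>i<n. \<bar>s (t e) i - e i\<bar> < e n)" for e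
  proof -
    have "(\<forall>h\<in>H. 0 < h e) \<longleftrightarrow> (\<forall>h\<in>G. 0 < h (t e)) \<and>
      (\<forall>i<n. 0 < e n - (s (t e) i - e i)) \<and> (\<forall>i<n. 0 < e n + (s (t e) i - e i))"
      unfolding H_def pull_def ball_Un ball_simps by (simp add: Ball_def)
    also have "\<dots> \<longleftrightarrow> (\<forall>h\<in>G. 0 < h (t e)) \<and> (\<forall>i<n. \<bar>s (t e) i - e i\<bar> < e n)"
      by (auto simp: abs_less_iff algebra_simps)
    finally show ?thesis .
  qed
  define R where "R e \<longleftrightarrow> (\<exists>e'. (\<forall>i. i \<notin> Z' \<longrightarrow> e' i = e i) \<and> basic {} H e')" for e
  have R: "semilin R" unfolding R_def[abs_def]
    by (intro semilin_ex_finite Z' funion_base linset_basic asys_empty H)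
  have Riff: "R (a(n := x)) \<longleftrightarrow> (\<exists>e. (\<forall>i. i \<notin> Z \<longrightarrow> e i = 0) \<and> (\<forall>h\<in>G. 0 < h e) \<and>
    (\<forall>i<n. \<bar>s e i - a i\<bar> < x))" for a x
  proof
    assume "R (a(n := x))"
    then obtain e' where e': "\<forall>i. i \<notin> Z' \<longrightarrow> e' i = (a(n := x)) i" "\<forall>h\<in>H. 0 < h e'"
      unfolding R_def basic_def by blast
    then have "e' n = x" "\<And>i. i < n \<Longrightarrow> e' i = a i" using Z'(2) by auto
    then show "\<exists>e. (\<forall>i. i \<notin> Z \<longrightarrow> e i = 0) \<and> (\<forall>h\<in>G. 0 < h e) \<and> (\<forall>i<n. \<bar>s e i - a i\<bar> < x)"
      using e'(2) unfolding Hiff by (intro exI[of _ "t e'"]) (simp add: t_def[of _ k for k])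
  next
    assume "\<exists>e. (\<forall>i. i \<notin> Z \<longrightarrow> e i = 0) \<and> (\<forall>h\<in>G. 0 < h e) \<and> (\<forall>i<n. \<bar>s e i - a i\<bar> < x)"
    then obtain e where e: "\<And>i. i \<notin> Z \<Longrightarrow> e i = 0" "\<forall>h\<in>G. 0 < h e" "\<forall>i<n. \<bar>s e i - a i\<bar> < x"
      by blast
    define e' where "e' k = (if k \<in> Z' then e (k - (n + 1)) else (a(n := x)) k)" for k
    have te: "t e' = e" using e(1) by (auto simp: t_def e'_def Z'_def fun_eq_iff)
    have "e' n = x" "\<And>i. i < n \<Longrightarrow> e' i = a i" using Z'(2) by (auto simp: e'_def)
    then have "\<forall>h\<in>H. 0 < h e'" unfolding Hiff te using e(2,3) by simp
    then show "R (a(n := x))" unfolding R_def basic_def by (intro exI[of _ e']) (auto simp: e'_def)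
  qed
  have "semilin (\<lambda>e. \<not> (\<exists>x. 0 < (e(n := x)) n \<and> \<not> R (e(n := x))))"
    by (rule semilin_not[OF semilin_ex[where P = "\<lambda>e. 0 < e n \<and> \<not> R e"]])
       (rule semilin_conj[OF funion_base[of linset, OF linset_pos[OF aff_var]] semilin_not[OF R]])
  moreover have "(\<lambda>e. \<not> (\<exists>x. 0 < (e(n := x)) n \<and> \<not> R (e(n := x)))) = (\<lambda>e. \<forall>x>0. R (e(n := x)))"
    by auto
  ultimately have "semilin (\<lambda>e. \<forall>x>0. R (e(n := x)))" by (simp only:)
  then show ?thesis unfolding Riff .
qed

section \<open>Density arguments with mixed rational and real coordinates\<close>

text \<open>
  Points of \<open>\<rat>\<^sup>J \<times> \<real>\<^sup>I\<close>; an affine map \<open>s\<close> will parametrise a definable set by a part of this space.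
\<close>

definition cfg :: "nat set \<Rightarrow> nat set \<Rightarrow> (nat \<Rightarrow> real) \<Rightarrow> bool" where
  "cfg J I e \<longleftrightarrow> (\<forall>i\<in>J. e i \<in> \<rat>) \<and> (\<forall>i. i \<notin> J \<union> I \<longrightarrow> e i = 0)"

text \<open>The coordinates in \<open>J\<close> are made rational one after another, each by a small
  move along its axis.\<close>

lemma ex_rational_near:
  assumes "finite J" "asys H" "\<forall>h\<in>H. 0 < h e"
  shows "\<exists>e'. (\<forall>i\<in>J. e' i \<in> \<rat>) \<and> (\<forall>i. i \<notin> J \<longrightarrow> e' i = e i) \<and> (\<forall>h\<in>H. 0 < h e')"
  using assms(1)
proof (induction J rule: finite_induct)
  case empty
  show ?case using assms(3) by blast
next
  case (insert j J)
  then obtain e' where e': "\<forall>i\<in>J. e' i \<in> \<rat>" "\<forall>i. i \<notin> J \<longrightarrow> e' i = e i" "\<forall>h\<in>H. 0 < h e'" by blast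
  define v where "v i = (if i = j then 1 else 0 :: real)" for i
  from asys_open[OF assms(2) e'(3), of v] obtain d where
    d: "0 < d" "\<And>t. \<bar>t\<bar> < d \<Longrightarrow> \<forall>h\<in>H. 0 < h (\<lambda>i. e' i + t * v i)" by blast
  obtain r where r: "r \<in> \<rat>" "e' j < r" "r < e' j + d"
    using Rats_dense_in_real[of "e' j" "e' j + d"] d(1) by auto
  have "(\<lambda>i. e' i + (r - e' j) * v i) = e'(j := r)" by (auto simp: v_def)
  then have "\<forall>h\<in>H. 0 < h (e'(j := r))" using d(2)[of "r - e' j"] r by simp
  moreover have "\<forall>i\<in>insert j J. (e'(j := r)) i \<in> \<rat>" "\<forall>i. i \<notin> insert j J \<longrightarrow> (e'(j := r)) i = e i"
    using e'(1,2) r(1) by auto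
  ultimately show ?case by blast
qed

text \<open>One takes a small rational step from \<open>e'\<close> towards a point \<open>e0\<close>
  where the new condition fails. A condition invariant in this direction is false on the whole
  rational line, as it fails at \<open>e'\<close> or at \<open>e0\<close>; every other one holds for
  at most one step size. Rational steps preserve \<open>cfg\<close>.\<close>

lemma ex_avoiding_near:
  assumes "finite T" "asys H" "\<forall>h\<in>H. 0 < h e" "cfg J I e"
    and "\<And>F. F \<in> T \<Longrightarrow> equational F" "\<And>F. F \<in> T \<Longrightarrow> \<exists>e0. cfg J I e0 \<and> \<not> F e0"
  shows "\<exists>e'. cfg J I e' \<and> (\<forall>h\<in>H. 0 < h e') \<and> (\<forall>F\<in>T. \<not> F e')"
  using assms(1,5,6)
proof (induction T rule: finite_induct)
  case empty
  show ?case using assms(3,4) by blast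
next
  case (insert F T)
  then obtain e' where e': "cfg J I e'" "\<forall>h\<in>H. 0 < h e'" "\<forall>F\<in>T. \<not> F e'" by blast
  obtain e0 where e0: "cfg J I e0" "\<not> F e0" using insert.prems by blast
  define v where "v i = e0 i - e' i" for i
  have v1: "(\<lambda>i. e' i + 1 * v i) = e0" by (simp add: v_def)
  from asys_open[OF assms(2) e'(2), of v] obtain d where
    d: "0 < d" "\<And>t. \<bar>t\<bar> < d \<Longrightarrow> \<forall>h\<in>H. 0 < h (\<lambda>i. e' i + t * v i)" by blast
  have "\<exists>t\<in>\<rat>. 0 < t \<and> t < d \<and> (\<forall>F'\<in>insert F T. \<not> F' (\<lambda>i. e' i + t * v i))"
  proof (rule ex_small_rational_avoiding)
    fix F' s t
    assume F': "F' \<in> insert F T" and st: "s \<in> \<rat>" "t \<in> \<rat>"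
      "F' (\<lambda>i. e' i + s * v i)" "F' (\<lambda>i. e' i + t * v i)"
    have "equational F'" using insert.prems(1) F' by blast
    from equational_dichotomy[OF this, of v] show "s = t"
    proof
      assume inv: "\<forall>e. \<forall>t\<in>\<rat>. F' (\<lambda>i. e i + t * v i) = F' e"
      have "\<not> F' e'"
      proof (cases "F' = F")
        case True
        have "F' e0 = F' e'" using inv[rule_format, of 1 e'] unfolding v1 by simp
        then show ?thesis using e0(2) True by simp
      qed (use F' e'(3) in blast)
      then show ?thesis using inv st by blast
    qed (use st in blast)
  qed (use insert.hyps d in auto)
  then obtain t where t: "t \<in> \<rat>" "0 < t" "t < d" "\<forall>F'\<in>insert F T. \<not> F' (\<lambda>i. e' i + t * v i)" by blast
  have "cfg J I (\<lambda>i. e' i + t * v i)" using e'(1) e0(1) t(1) by (simp add: cfg_def v_def)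
  moreover have "\<forall>h\<in>H. 0 < h (\<lambda>i. e' i + t * v i)" using d(2)[of t] t by simp
  ultimately show ?case using t(4) by blast
qed

text \<open>Induction on the number of coordinates. An equation that involves one of them expresses
  it by the others, and this is substituted everywhere, including in the parametrisation
  \<open>s\<close>. When no equation involves a coordinate any more, the remaining set is dense in
  an open polyhedron, unless it is empty, and \<open>semilin_limit\<close> applies.\<close>

lemma cfg_limit_semilin:
  assumes "finite J" "finite I" "J \<inter> I = {}" "asys E" "asys G" "finite T" "\<And>F. F \<in> T \<Longrightarrow> equational F"
    "\<And>i. aff (\<lambda>e. s e i)"
  shows "semilin (\<lambda>a. \<forall>\<epsilon>>0. \<exists>e. cfg J I e \<and> basic E G e \<and> (\<forall>F\<in>T. \<not> F e) \<and>
    (\<forall>i<n. \<bar>s e i - a i\<bar> < \<epsilon>))"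
  using assms
proof (induction "card J + card I" arbitrary: J I E G T s rule: less_induct)
  case less
  note J = less.prems(1) and I = less.prems(2) and JI = less.prems(3)
    and E = less.prems(4) and G = less.prems(5) and T = less.prems(6,7) and s = less.prems(8)
  \<comment> \<open>The common elimination step: coordinate \<open>j\<close> is replaced by the
    affine form \<open>u\<close>, leaving fewer coordinates.\<close>
  have step: ?case if u: "aff u" and c: "card J' + card I' < card J + card I"
    and J': "J' \<subseteq> J" "I' \<subseteq> I"
    and 1: "\<And>e. cfg J I e \<Longrightarrow> basic E G e \<Longrightarrow> \<exists>e0. cfg J' I' e0 \<and> e0(j := u e0) = e"
    and 2: "\<And>e. cfg J' I' e \<Longrightarrow> cfg J I (e(j := u e))" for u j J' I'
  proof -
    let ?s = "\<lambda>e. e(j := u e)"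
    note au = aff_upd[OF u, of j]
    have "(\<exists>e. cfg J I e \<and> basic E G e \<and> Q e) \<longleftrightarrow> (\<exists>e. cfg J' I' e \<and> basic E G (?s e) \<and> Q (?s e))" for Q
    proof
      assume "\<exists>e. cfg J I e \<and> basic E G e \<and> Q e"
      then obtain e where e: "cfg J I e" "basic E G e" "Q e" by blast
      then obtain e0 where "cfg J' I' e0" "?s e0 = e" using 1 by blast
      then show "\<exists>e. cfg J' I' e \<and> basic E G (?s e) \<and> Q (?s e)" using e by blast
    qed (use 2 in blast)
    moreover have "semilin (\<lambda>a. \<forall>\<epsilon>>0. \<exists>e. cfg J' I' e \<and> basic (pull ?s E) (pull ?s G) e \<and>
      (\<forall>F\<in>(\<lambda>F e. F (?s e)) ` T. \<not> F e) \<and> (\<forall>i<n. \<bar>s (?s e) i - a i\<bar> < \<epsilon>))"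
    proof (rule less.hyps[OF c])
      show "aff (\<lambda>e. s (?s e) i)" for i by (rule aff_subst[OF s, of ?s, OF au])
      show "equational F" if "F \<in> (\<lambda>F e. F (?s e)) ` T" for F
      proof -
        from that obtain F0 where "F0 \<in> T" "F = (\<lambda>e. F0 (?s e))" by blast
        then show ?thesis using equational_subst[OF T(2), of F0 ?s, OF _ au] by simp
      qed
    qed (use J' J I JI T(1) in \<open>auto intro: finite_subset asys_pull[OF E, of ?s, OF au] asys_pull[OF G, of ?s, OF au]\<close>)
    ultimately show ?thesis by (simp add: basic_pull)
  qed
  have fin: "finite (J \<union> I)" using J I by simp
  have "\<forall>g\<in>E. \<exists>k. (\<forall>i. k i \<in> K) \<and>
     (\<forall>e. (\<forall>i. i \<notin> J \<union> I \<longrightarrow> e i = 0) \<longrightarrow> g e = g (\<lambda>_. 0) + (\<Sum>i\<in>J \<union> I. k i * e i))"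
    using aff_coeffs[OF fin] asysD[OF E] by blast
  then obtain k where k: "\<And>g e. g \<in> E \<Longrightarrow> \<forall>i. i \<notin> J \<union> I \<longrightarrow> e i = 0 \<Longrightarrow>
      g e = g (\<lambda>_. 0) + (\<Sum>i\<in>J \<union> I. k g i * e i)" by metis
  \<comment> \<open>A real coordinate can be solved for directly. An equation in rational
    coordinates only needs the retraction onto \<rat>, since its solution must be rational at every
    remaining configuration.\<close>
  consider (real) g j where "g \<in> E" "j \<in> I" "k g j \<noteq> 0"
    | (rational) g j where "g \<in> E" "\<forall>i\<in>I. k g i = 0" "j \<in> J" "k g j \<noteq> 0"
    | (const) "\<forall>g\<in>E. \<forall>i\<in>J \<union> I. k g i = 0" by blast
  then show ?case
  proof cases
    case real
    define v where "v = (\<lambda>_. 0 :: real)(j := 1)"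
    have "g v = g (\<lambda>_. 0) + (\<Sum>i\<in>J \<union> I. if i = j then k g j else 0)"
      by (subst k[OF real(1)]) (use real(2) in \<open>auto simp: v_def intro!: sum.cong\<close>)
    also have "\<dots> = g (\<lambda>_. 0) + k g j" using real(2) fin by simp
    finally have "g v = g (\<lambda>_. 0) + k g j" .
    moreover have "(\<lambda>_. 0 :: real)(j := 0) = (\<lambda>_. 0)" by auto
    ultimately have ne: "g ((\<lambda>_. 0)(j := 1)) \<noteq> g ((\<lambda>_. 0)(j := 0))" using real(3) by (simp only: v_def)
    obtain u where u: "aff u" "\<And>e x. g (e(j := x)) = 0 \<longleftrightarrow> x = u e"
      using solve_for_variable[OF asysD[OF E real(1)] ne] by blast
    show ?thesis
    proof (rule step[OF u(1), of J "I - {j}"])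
      show "card J + card (I - {j}) < card J + card I" using card_Diff1_less[OF I real(2)] by simp
      show "\<exists>e0. cfg J (I - {j}) e0 \<and> e0(j := u e0) = e" if "cfg J I e" "basic E G e" for e
      proof (intro exI conjI)
        show "cfg J (I - {j}) (e(j := 0))" using that(1) real(2) JI by (auto simp: cfg_def)
        have "g ((e(j := 0))(j := e j)) = 0" using that(2) real(1) by (simp add: basic_def)
        then show "(e(j := 0))(j := u (e(j := 0))) = e" unfolding u(2) by (metis fun_upd_triv fun_upd_upd)
      qed
      show "cfg J I (e(j := u e))" if "cfg J (I - {j}) e" for e
        using that real(2) JI by (auto simp: cfg_def)
    qed auto
  next
    case rational
    obtain f :: "real \<Rightarrow> real" where f: "\<And>x y. f (x + y) = f x + f y"
      "\<And>q x. q \<in> \<rat> \<Longrightarrow> f (q * x) = q * f x" "\<And>x. f x \<in> \<rat>" "\<And>q. q \<in> \<rat> \<Longrightarrow> f q = q"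
      using ex_rational_functional by blast
    have f0: "f 0 = 0" using f(4)[of 0] by simp
    have fr: "f (x * q) = f x * q" if "q \<in> \<rat>" for x q using f(2)[OF that, of x] by (simp add: mult.commute)
    have fsum: "f (\<Sum>i\<in>A. c i * e i) = (\<Sum>i\<in>A. f (c i) * e i)" if "\<forall>i\<in>A. e i \<in> \<rat>" for A c e
      using that by (induction A rule: infinite_finite_induct) (auto simp: f0 f(1) fr)
    define c where "c i = - (k g i / k g j)" for i
    \<comment> \<open>The retraction fixes the rational unknowns and makes the coefficients
      rational. The new equation is only a consequence of \<open>g e = 0\<close>; nothing is lost,
      because \<open>g\<close> stays in the system that is pulled back.\<close>
    define u where "u e = f (- (g (\<lambda>_. 0) / k g j)) + (\<Sum>i\<in>J - {j}. f (c i) * e i)" for e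
    have u: "aff u" unfolding u_def[abs_def]
      by (intro aff_add aff_const aff_sum aff_scale aff_var K_Rats f(3))
    have u_eq: "e j = u e" if e: "cfg J I e" "g e = 0" for e
    proof -
      have "(\<Sum>i\<in>J \<union> I. k g i * e i) = (\<Sum>i\<in>J. k g i * e i)"
        using rational(2) fin by (intro sum.mono_neutral_right) auto
      also have "\<dots> = k g j * e j + (\<Sum>i\<in>J - {j}. k g i * e i)" using J rational(3) by (rule sum.remove)
      finally have "0 = g (\<lambda>_. 0) + (k g j * e j + (\<Sum>i\<in>J - {j}. k g i * e i))"
        using k[OF rational(1), of e] e unfolding cfg_def by simp
      then have "e j = - (g (\<lambda>_. 0) / k g j) - (\<Sum>i\<in>J - {j}. k g i * e i) / k g j"
        using rational(4) by (simp add: field_simps)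
      also have "\<dots> = - (g (\<lambda>_. 0) / k g j) + (\<Sum>i\<in>J - {j}. c i * e i)"
        by (simp add: c_def sum_divide_distrib sum_negf)
      finally have "f (e j) = f (\<dots>)" by (rule arg_cong)
      moreover have "f (e j) = e j" using e(1) rational(3) by (intro f(4)) (simp add: cfg_def)
      ultimately show ?thesis unfolding u_def f(1) using fsum[of "J - {j}" e c] e(1) by (simp add: cfg_def)
    qed
    have ju: "u (e(j := x)) = u e" for e x unfolding u_def by (intro arg_cong2[where f = plus] refl sum.cong) auto
    show ?thesis
    proof (rule step[OF u, of "J - {j}" I])
      show "card (J - {j}) + card I < card J + card I" using card_Diff1_less[OF J rational(3)] by simp
      show "\<exists>e0. cfg (J - {j}) I e0 \<and> e0(j := u e0) = e" if "cfg J I e" "basic E G e" for e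
      proof (intro exI conjI)
        show "cfg (J - {j}) I (e(j := 0))" using that(1) rational(3) JI by (auto simp: cfg_def)
        have "e j = u e" using u_eq[OF that(1)] that(2) rational(1) by (simp add: basic_def)
        then show "(e(j := 0))(j := u (e(j := 0))) = e" unfolding ju by (metis fun_upd_triv fun_upd_upd)
      qed
      show "cfg J I (e(j := u e))" if "cfg (J - {j}) I e" for e
      proof -
        have "u e \<in> \<rat>" unfolding u_def
          using that f(3) by (intro Rats_add Rats_sum Rats_mult) (auto simp: cfg_def)
        then show ?thesis using that rational(3) by (auto simp: cfg_def)
      qed
    qed auto
  next
    case const
    have Ec: "g e = g (\<lambda>_. 0)" if "g \<in> E" "cfg J I e" for g e
      using k[OF that(1), of e] that const by (simp add: cfg_def)
    show ?thesis
    \<comment> \<open>In the first case the set is empty. In the second, each negated condition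
      fails to hold at some configuration, as \<open>ex_avoiding_near\<close> requires.\<close>
    proof (cases "(\<exists>g\<in>E. g (\<lambda>_. 0) \<noteq> 0) \<or> (\<exists>F\<in>T. \<forall>e. cfg J I e \<longrightarrow> F e)")
      case True
      then have "\<not> (cfg J I e \<and> basic E G e \<and> (\<forall>F\<in>T. \<not> F e))" for e
        using Ec unfolding basic_def by metis
      then have "(\<lambda>a. \<forall>\<epsilon>>0. \<exists>e. cfg J I e \<and> basic E G e \<and> (\<forall>F\<in>T. \<not> F e) \<and>
        (\<forall>i<n. \<bar>s e i - a i\<bar> < \<epsilon>)) = (\<lambda>_. False)" by (metis zero_less_one)
      then show ?thesis using funion_empty[of linset] by simp
    next
      case False
      have "(\<exists>e. cfg J I e \<and> basic E G e \<and> (\<forall>F\<in>T. \<not> F e) \<and> (\<forall>i<n. \<bar>s e i - a i\<bar> < \<epsilon>)) \<longleftrightarrow>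
        (\<exists>e. (\<forall>i. i \<notin> J \<union> I \<longrightarrow> e i = 0) \<and> (\<forall>h\<in>G. 0 < h e) \<and> (\<forall>i<n. \<bar>s e i - a i\<bar> < \<epsilon>))" for a \<epsilon>
      proof
        assume "\<exists>e. (\<forall>i. i \<notin> J \<union> I \<longrightarrow> e i = 0) \<and> (\<forall>h\<in>G. 0 < h e) \<and> (\<forall>i<n. \<bar>s e i - a i\<bar> < \<epsilon>)"
        then obtain e where e: "\<forall>i. i \<notin> J \<union> I \<longrightarrow> e i = 0" "\<forall>h\<in>G. 0 < h e" "\<forall>i<n. \<bar>s e i - a i\<bar> < \<epsilon>"
          by blast
        \<comment> \<open>Closeness to \<open>a\<close> is added as strict inequalities, so that
          making coordinates rational and avoiding \<open>T\<close> both preserve it.\<close>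
        define H where "H = G \<union> (\<lambda>i e. \<epsilon> - (s e i - a i)) ` {..<n} \<union> (\<lambda>i e. \<epsilon> + (s e i - a i)) ` {..<n}"
        have H: "asys H" unfolding H_def
          by (intro asys_Un G asys_image finite_lessThan aff_add aff_diff aff_const s)
        have Hiff: "(\<forall>h\<in>H. 0 < h e) \<longleftrightarrow> (\<forall>h\<in>G. 0 < h e) \<and> (\<forall>i<n. \<bar>s e i - a i\<bar> < \<epsilon>)" for e
        proof -
          have "(\<forall>h\<in>H. 0 < h e) \<longleftrightarrow> (\<forall>h\<in>G. 0 < h e) \<and>
            (\<forall>i<n. 0 < \<epsilon> - (s e i - a i)) \<and> (\<forall>i<n. 0 < \<epsilon> + (s e i - a i))"
            unfolding H_def ball_Un ball_simps by (simp add: Ball_def)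
          also have "\<dots> \<longleftrightarrow> (\<forall>h\<in>G. 0 < h e) \<and> (\<forall>i<n. \<bar>s e i - a i\<bar> < \<epsilon>)"
            by (auto simp: abs_less_iff algebra_simps)
          finally show ?thesis .
        qed
        have "\<forall>h\<in>H. 0 < h e" unfolding Hiff using e by blast
        from ex_rational_near[OF J H this] obtain e1 where
          e1: "\<forall>i\<in>J. e1 i \<in> \<rat>" "\<forall>i. i \<notin> J \<longrightarrow> e1 i = e i" "\<forall>h\<in>H. 0 < h e1" by blast
        have "cfg J I e1" unfolding cfg_def using e1(1,2) e(1) by simp
        from ex_avoiding_near[OF T(1) H e1(3) this T(2)] False obtain e2 where
          e2: "cfg J I e2" "\<forall>h\<in>H. 0 < h e2" "\<forall>F\<in>T. \<not> F e2" by blast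
        have "\<forall>g\<in>E. g e2 = 0" using Ec[OF _ e2(1)] False by metis
        then show "\<exists>e. cfg J I e \<and> basic E G e \<and> (\<forall>F\<in>T. \<not> F e) \<and> (\<forall>i<n. \<bar>s e i - a i\<bar> < \<epsilon>)"
          using e2 unfolding Hiff basic_def by blast
      qed (auto simp: cfg_def basic_def)
      then show ?thesis using semilin_limit[OF fin G, of s n, OF s] by simp
    qed
  qed
qed

section \<open>Closures of predicates in normal form\<close>

text \<open>Membership in the closure of \<open>P\<close> in \<open>\<real>\<^sup>n\<close>.\<close>

definition limit :: "nat \<Rightarrow> ((nat \<Rightarrow> real) \<Rightarrow> bool) \<Rightarrow> (nat \<Rightarrow> real) \<Rightarrow> bool" where
  "limit n P a \<longleftrightarrow> (\<forall>\<epsilon>>0. \<exists>e. (\<forall>i\<ge>n. e i = 0) \<and> P e \<and> (\<forall>i<n. \<bar>e i - a i\<bar> < \<epsilon>))"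

text \<open>Closure commutes with finite unions, as \<open>funion_bind\<close> requires; a common
  bound is the minimum of the two.\<close>

lemma limit_disj: "limit n (\<lambda>e. P e \<or> Q e) = (\<lambda>a. limit n P a \<or> limit n Q a)"
proof (intro ext iffI)
  fix a assume PQ: "limit n (\<lambda>e. P e \<or> Q e) a"
  show "limit n P a \<or> limit n Q a"
  proof (rule ccontr)
    assume "\<not> (limit n P a \<or> limit n Q a)"
    then obtain \<epsilon> \<delta> where ed: "0 < \<epsilon>" "0 < \<delta>"
      "\<And>e. (\<forall>i\<ge>n. e i = 0) \<Longrightarrow> P e \<Longrightarrow> \<not> (\<forall>i<n. \<bar>e i - a i\<bar> < \<epsilon>)"
      "\<And>e. (\<forall>i\<ge>n. e i = 0) \<Longrightarrow> Q e \<Longrightarrow> \<not> (\<forall>i<n. \<bar>e i - a i\<bar> < \<delta>)"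
      unfolding limit_def by metis
    then obtain e where "\<forall>i\<ge>n. e i = 0" "P e \<or> Q e" "\<forall>i<n. \<bar>e i - a i\<bar> < min \<epsilon> \<delta>"
      using PQ[unfolded limit_def, rule_format, of "min \<epsilon> \<delta>"] by auto
    then show False using ed(3,4)[of e] by auto
  qed
qed (auto simp: limit_def; blast)

text \<open>The rational witnesses become further coordinates of a configuration, with indices
  chosen beyond those of the point, and the parametrisation is the identity, compared with
  \<open>a\<close> only at indices below \<open>n\<close>.\<close>

lemma piece_limit:
  assumes "piece P"
  shows "semilin (limit n P)"
proof -
  obtain S T where S: "special S" and T: "finite T" "\<And>F. F \<in> T \<Longrightarrow> equational F"
    and P: "P = (\<lambda>e. S e \<and> (\<forall>F\<in>T. \<not> F e))"
    using assms unfolding piece_def by blast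
  have "\<forall>F\<in>T. \<exists>Z. supp Z F" using T(2) equational_special special_supp by blast
  then obtain Z where Z: "\<And>F. F \<in> T \<Longrightarrow> supp (Z F) F" by metis
  have "finite ({..<n} \<union> (\<Union>F\<in>T. Z F))" using T(1) Z by (auto simp: supp_def)
  then obtain J E G where J: "finite J" "asys E" "asys G" "J \<inter> ({..<n} \<union> (\<Union>F\<in>T. Z F)) = {}"
    "S = qex J (basic E G)" using special_fresh[OF S] by metis
  have nJ: "i \<notin> J" if "i < n" for i using J(4) that by blast
  have indep: "F e = F e'" if "F \<in> T" "\<And>i. i \<notin> J \<Longrightarrow> e i = e' i" for F e e'
    by (rule suppD[OF Z[OF that(1)]]) (use that J(4) in auto)
  have "(\<exists>e. (\<forall>i\<ge>n. e i = 0) \<and> P e \<and> (\<forall>i<n. \<bar>e i - a i\<bar> < \<epsilon>)) \<longleftrightarrow>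
    (\<exists>e. cfg J {..<n} e \<and> basic E G e \<and> (\<forall>F\<in>T. \<not> F e) \<and> (\<forall>i<n. \<bar>e i - a i\<bar> < \<epsilon>))" for a \<epsilon>
  proof
    assume "\<exists>e. (\<forall>i\<ge>n. e i = 0) \<and> P e \<and> (\<forall>i<n. \<bar>e i - a i\<bar> < \<epsilon>)"
    then obtain e where e: "\<forall>i\<ge>n. e i = 0" "qex J (basic E G) e" "\<forall>F\<in>T. \<not> F e" "\<forall>i<n. \<bar>e i - a i\<bar> < \<epsilon>"
      unfolding P J(5) by blast
    from e(2) obtain e1 where e1: "\<And>i. i \<notin> J \<Longrightarrow> e1 i = e i" "\<And>i. i \<in> J \<Longrightarrow> e1 i \<in> \<rat>" "basic E G e1"
      by (elim qexE) blast
    have "cfg J {..<n} e1" using e1 e(1) by (simp add: cfg_def not_less)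
    moreover have "\<forall>F\<in>T. \<not> F e1" using indep[of _ e1 e] e1(1) e(3) by blast
    moreover have "\<forall>i<n. \<bar>e1 i - a i\<bar> < \<epsilon>" using e(4) e1(1) nJ by simp
    ultimately show "\<exists>e. cfg J {..<n} e \<and> basic E G e \<and> (\<forall>F\<in>T. \<not> F e) \<and> (\<forall>i<n. \<bar>e i - a i\<bar> < \<epsilon>)"
      using e1(3) by blast
  next
    assume "\<exists>e. cfg J {..<n} e \<and> basic E G e \<and> (\<forall>F\<in>T. \<not> F e) \<and> (\<forall>i<n. \<bar>e i - a i\<bar> < \<epsilon>)"
    then obtain e1 where e1: "cfg J {..<n} e1" "basic E G e1" "\<forall>F\<in>T. \<not> F e1" "\<forall>i<n. \<bar>e1 i - a i\<bar> < \<epsilon>"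
      by blast
    \<comment> \<open>Forgetting the witness entries returns to a point of
      \<open>\<real>\<^sup>n\<close>; all indices in \<open>J\<close> are at least
      \<open>n\<close>.\<close>
    define e where "e i = (if i \<in> J then 0 else e1 i)" for i
    have "qex J (basic E G) e" using e1 by (intro qexI[of _ e1]) (auto simp: e_def cfg_def)
    moreover have "F e1 = F e" if "F \<in> T" for F by (rule indep[OF that]) (simp add: e_def)
    then have "\<forall>F\<in>T. \<not> F e" using e1(3) by blast
    moreover have "\<forall>i\<ge>n. e i = 0" using e1(1) by (simp add: e_def cfg_def)
    moreover have "\<forall>i<n. \<bar>e i - a i\<bar> < \<epsilon>" using e1(4) nJ by (simp add: e_def)
    ultimately show "\<exists>e. (\<forall>i\<ge>n. e i = 0) \<and> P e \<and> (\<forall>i<n. \<bar>e i - a i\<bar> < \<epsilon>)" unfolding P J(5) by blast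
  qed
  then have "limit n P = (\<lambda>a. \<forall>\<epsilon>>0. \<exists>e. cfg J {..<n} e \<and> basic E G e \<and> (\<forall>F\<in>T. \<not> F e) \<and>
    (\<forall>i<n. \<bar>e i - a i\<bar> < \<epsilon>))" by (simp add: limit_def[abs_def])
  moreover have "J \<inter> {..<n} = {}" using J(4) by blast
  ultimately show ?thesis
    using cfg_limit_semilin[OF J(1) finite_lessThan _ J(2,3) T, of n "\<lambda>e. e" n] aff_var by simp
qed

lemma nf_limit: "nf P \<Longrightarrow> semilin (limit n P)"
  by (rule funion_bind[where f = "limit n" and C = piece])
     (auto simp: limit_disj piece_limit, auto simp: limit_def fun_eq_iff intro: exI[of _ 1])

end

section \<open>Definability\<close>

lemma tm_val_cong: "is_tm K n t \<Longrightarrow> (\<And>i. i < n \<Longrightarrow> e i = e' i) \<Longrightarrow> tm_val e t = tm_val e' t"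
  by (induction t) auto

lemma sat_cong: "is_fm K n f \<Longrightarrow> (\<And>i. i < n \<Longrightarrow> e i = e' i) \<Longrightarrow> sat P e f = sat P e' f"
proof (induction f arbitrary: n e e')
  case (FEq s t)
  then show ?case using tm_val_cong[of K n _ e e'] by auto
next
  case (FLess s t)
  then show ?case using tm_val_cong[of K n _ e e'] by auto
next
  case (FPred t)
  then show ?case using tm_val_cong[of K n t e e'] by auto
next
  case (FNeg f)
  have "sat P e f = sat P e' f" by (rule FNeg.IH[of n]) (use FNeg.prems in simp_all)
  then show ?case by simp
next
  case (FConj f g)
  have "sat P e f = sat P e' f" by (rule FConj.IH(1)[of n]) (use FConj.prems in simp_all)
  moreover have "sat P e g = sat P e' g" by (rule FConj.IH(2)[of n]) (use FConj.prems in simp_all)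
  ultimately show ?case by simp
next
  case (FEx f)
  have "sat P (case_nat x e) f = sat P (case_nat x e') f" for x
    by (rule FEx.IH[of "Suc n"]) (use FEx.prems in \<open>auto split: nat.split\<close>)
  then show ?case by simp
qed

text \<open>A basic neighbourhood in the product topology restricts each coordinate, but points of
  \<open>Rn n\<close> agree from index \<open>n\<close> on, so the minimum of \<open>n\<close> radii
  suffices.\<close>

lemma openin_Euclidean_space_box:
  assumes "openin (Euclidean_space n) U" "a \<in> U"
  shows "\<exists>\<epsilon>>0. \<forall>e\<in>Rn n. (\<forall>i<n. \<bar>e i - a i\<bar> < \<epsilon>) \<longrightarrow> e \<in> U"
proof -
  obtain V where V: "openin (powertop_real UNIV) V" "U = V \<inter> {x. \<forall>i\<ge>n. x i = 0}"
    using assms(1) unfolding Euclidean_space_def openin_subtopology by blast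
  have "a \<in> V" "\<forall>i\<ge>n. a i = 0" using assms(2) V(2) by auto
  then have "\<exists>W. finite {i. W i \<noteq> UNIV} \<and> (\<forall>i. open (W i)) \<and> a \<in> Pi\<^sub>E UNIV W \<and> Pi\<^sub>E UNIV W \<subseteq> V"
    using V(1) unfolding openin_product_topology_alt by auto
  then obtain W where W: "\<And>i. open (W i)" "a \<in> Pi\<^sub>E UNIV W" "Pi\<^sub>E UNIV W \<subseteq> V" by blast
  have "\<forall>i. \<exists>d>0. \<forall>y. \<bar>y - a i\<bar> < d \<longrightarrow> y \<in> W i"
  proof
    fix i
    have "a i \<in> W i" using W(2) by auto
    then show "\<exists>d>0. \<forall>y. \<bar>y - a i\<bar> < d \<longrightarrow> y \<in> W i"
      using W(1)[of i] unfolding open_dist dist_real_def by blast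
  qed
  then obtain d where d: "\<And>i. 0 < d i" "\<And>i y. \<bar>y - a i\<bar> < d i \<Longrightarrow> y \<in> W i" by metis
  \<comment> \<open>The entry 1 covers the case \<open>n = 0\<close>.\<close>
  define \<epsilon> where "\<epsilon> = Min (insert 1 (d ` {..<n}))"
  have "0 < \<epsilon>" using d(1) by (simp add: \<epsilon>_def)
  moreover have "e \<in> U" if "e \<in> Rn n" "\<forall>i<n. \<bar>e i - a i\<bar> < \<epsilon>" for e
  proof -
    have "e i \<in> W i" for i
    proof (cases "i < n")
      case True
      then have "\<epsilon> \<le> d i" unfolding \<epsilon>_def by (intro Min_le) auto
      then show ?thesis using that(2) True d(2) by force
    next
      case False
      then have "e i = a i" using that(1) \<open>\<forall>i\<ge>n. a i = 0\<close> by (simp add: topspace_Euclidean_space)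
      then show ?thesis using d by simp
    qed
    then show ?thesis using W(3) V(2) that(1) by (auto simp: topspace_Euclidean_space)
  qed
  ultimately show ?thesis by blast
qed

context real_subfield begin

section \<open>From formulas to the normal form\<close>

lemma aff_tm_val: "is_tm K n t \<Longrightarrow> aff (\<lambda>e. tm_val e t)"
  by (induction t) (auto intro: aff.intros)

lemma sat_nf: "is_fm K n f \<Longrightarrow> nf (\<lambda>e. sat \<rat> e f)"
proof (induction f arbitrary: n)
  case (FEq s t)
  have "(\<lambda>e. sat \<rat> e (FEq s t)) = basic {\<lambda>e. tm_val e s - tm_val e t} {}" by (auto simp: basic_def fun_eq_iff)
  then show ?case using FEq aff_tm_val
    by (simp only:) (rule special_nf special_basic asys_insert asys_empty aff_diff | auto)+
next
  case (FLess s t)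
  have "(\<lambda>e. sat \<rat> e (FLess s t)) = basic {} {\<lambda>e. tm_val e t - tm_val e s}" by (auto simp: basic_def fun_eq_iff)
  then show ?case using FLess aff_tm_val
    by (simp only:) (rule special_nf special_basic asys_insert asys_empty aff_diff | auto)+
next
  case (FPred t)
  then have t: "is_tm K n t" by simp
  \<comment> \<open>Variable \<open>n\<close> is fresh for \<open>t\<close>, so it can serve as the
    rational number equal to the value of \<open>t\<close>.\<close>
  have "tm_val (e(n := r)) t = tm_val e t" for e r by (rule tm_val_cong[OF t]) simp
  then have "(\<lambda>e. sat \<rat> e (FPred t)) = qex {n} (basic {\<lambda>e. e n - tm_val e t} {})"
    by (auto simp: basic_def fun_eq_iff qex_single)
  moreover have "special (qex {n} (basic {\<lambda>e. e n - tm_val e t} {}))"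
    by (intro qex_special special_basic asys_insert asys_empty aff_diff aff_var aff_tm_val[OF t]) simp
  ultimately show ?case using special_nf by simp
next
  case (FNeg f)
  then show ?case using nf_not[of "\<lambda>e. sat \<rat> e f"] by simp
next
  case (FConj f g)
  then show ?case using nf_conj[OF FConj.IH(1)[of n] FConj.IH(2)[of n]] by simp
next
  case (FEx f)
  then have f: "is_fm K (Suc n) f" by simp
  \<comment> \<open>The de Bruijn shift is an affine substitution that feeds slot 0 from variable
    \<open>n\<close>. As \<open>n\<close> is not free in the quantified formula, the quantifier over
    slot 0 becomes an update at \<open>n\<close>.\<close>
  have "aff (\<lambda>e. case_nat (e n) e i)" for i by (cases i) (auto intro: aff_var)
  then have "nf (\<lambda>e. sat \<rat> (case_nat (e n) e) f)"
    using nf_subst[OF FEx.IH[OF f], of "\<lambda>e. case_nat (e n) e"] by simp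
  then have "nf (\<lambda>e. \<exists>x. sat \<rat> (case_nat ((e(n := x)) n) (e(n := x))) f)" by (rule nf_ex)
  moreover have "sat \<rat> (case_nat ((e(n := x)) n) (e(n := x))) f = sat \<rat> (case_nat x e) f" for e x
    by (rule sat_cong[OF f]) (auto split: nat.split)
  ultimately show ?case by simp
qed

section \<open>From predicates back to definable sets\<close>

lemma aff_term:
  assumes "\<And>i. \<exists>t. is_tm K N t \<and> (\<forall>e. tm_val e t = s e i)"
  shows "aff g \<Longrightarrow> \<exists>t. is_tm K N t \<and> (\<forall>e. tm_val e t = g (s e))"
proof (induction rule: aff.induct)
  case (aff_var i)
  show ?case by (rule assms)
next
  case (aff_const c)
  show ?case by (intro exI[of _ "Param c"]) simp
next
  case (aff_add g h)
  then obtain t t' where "is_tm K N t" "\<forall>e. tm_val e t = g (s e)" "is_tm K N t'" "\<forall>e. tm_val e t' = h (s e)"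
    by blast
  then show ?case by (intro exI[of _ "Plus t t'"]) simp
next
  case (aff_scale k g)
  then obtain t where "is_tm K N t" "\<forall>e. tm_val e t = g (s e)" by blast
  then show ?case using aff_scale.hyps by (intro exI[of _ "Lam k t"]) simp
qed

text \<open>The substitution \<open>s\<close> serves two purposes: it cuts environments off at the
  dimension, and it distributes a tuple over rational witnesses and point.\<close>

lemma basic_formula:
  assumes s: "\<And>i. \<exists>t. is_tm K N t \<and> (\<forall>e. tm_val e t = s e i)" and E: "asys E" and G: "asys G"
  shows "\<exists>f. is_fm K N f \<and> pred_free f \<and> (\<forall>e. sat {} e f = basic E G (s e))"
proof -
  have ball: "\<exists>f. is_fm K N f \<and> pred_free f \<and> (\<forall>e. sat {} e f = (\<forall>g\<in>A. R (g (s e))))"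
    if "finite A" "\<And>g. g \<in> A \<Longrightarrow> \<exists>f. is_fm K N f \<and> pred_free f \<and> (\<forall>e. sat {} e f = R (g (s e)))"
    for A :: "((nat \<Rightarrow> real) \<Rightarrow> real) set" and R
    using that
  proof (induction A rule: finite_induct)
    case empty
    show ?case by (intro exI[of _ "FEq (Param 0) (Param 0)"]) simp
  next
    case (insert g A)
    obtain f' where "is_fm K N f' \<and> pred_free f' \<and> (\<forall>e. sat {} e f' = R (g (s e)))"
      using insert.prems[of g] by blast
    moreover have "\<exists>f. is_fm K N f \<and> pred_free f \<and> (\<forall>e. sat {} e f = (\<forall>g\<in>A. R (g (s e))))"
      by (rule insert.IH, rule insert.prems) simp
    then obtain f where "is_fm K N f \<and> pred_free f \<and> (\<forall>e. sat {} e f = (\<forall>g\<in>A. R (g (s e))))" by blast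
    ultimately show ?case by (intro exI[of _ "FConj f' f"]) simp
  qed
  have "\<exists>f. is_fm K N f \<and> pred_free f \<and> (\<forall>e. sat {} e f = (g (s e) = 0))" if "g \<in> E" for g
  proof -
    from aff_term[of N s, OF s asysD[OF E that]] obtain t where "is_tm K N t" "\<forall>e. tm_val e t = g (s e)" by blast
    then show ?thesis by (intro exI[of _ "FEq t (Param 0)"]) simp
  qed
  from ball[OF asys_finite[OF E], of "\<lambda>x. x = 0", OF this] obtain f where
    f: "is_fm K N f" "pred_free f" "\<And>e. sat {} e f = (\<forall>g\<in>E. g (s e) = 0)" by blast
  have "\<exists>f. is_fm K N f \<and> pred_free f \<and> (\<forall>e. sat {} e f = (0 < h (s e)))" if "h \<in> G" for h
  proof -
    from aff_term[of N s, OF s asysD[OF G that]] obtain t where "is_tm K N t" "\<forall>e. tm_val e t = h (s e)" by blast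
    then show ?thesis by (intro exI[of _ "FLess (Param 0) t"]) simp
  qed
  from ball[OF asys_finite[OF G], of "\<lambda>x. 0 < x", OF this] obtain f' where
    f': "is_fm K N f'" "pred_free f'" "\<And>e. sat {} e f' = (\<forall>h\<in>G. 0 < h (s e))" by blast
  show ?thesis using f f' by (intro exI[of _ "FConj f f'"]) (simp add: basic_def)
qed

lemma semilin_definable:
  assumes "semilin P"
  shows "definable_RK K n {x \<in> Rn n. P x}"
proof -
  \<comment> \<open>A formula for a subset of \<open>\<real>\<^sup>n\<close> may only mention
    variables below \<open>n\<close>. Reading 0 beyond them changes nothing at points of
    \<open>Rn n\<close>.\<close>
  define s where "s e i = (if i < n then e i else 0 :: real)" for e i
  have s: "\<exists>t. is_tm K n t \<and> (\<forall>e. tm_val e t = s e i)" for i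
    by (cases "i < n") (auto simp: s_def intro: exI[of _ "Var i"] exI[of _ "Param 0"])
  have "\<exists>f. is_fm K n f \<and> pred_free f \<and> (\<forall>e. sat {} e f = P (s e))"
    using assms
  proof (induction rule: funion.induct)
    case funion_empty
    show ?case by (intro exI[of _ "FLess (Param 0) (Param 0)"]) simp
  next
    case (funion_insert p q)
    obtain f where f: "is_fm K n f" "pred_free f" "\<forall>e. sat {} e f = q (s e)" using funion_insert.IH by blast
    obtain E G where "asys E" "asys G" "p = basic E G"
      using funion_insert.hyps(1) unfolding linset_def by blast
    then obtain f' where f': "is_fm K n f'" "pred_free f'" "\<forall>e. sat {} e f' = p (s e)"
      using basic_formula[of n s E G, OF s] by blast
    show ?case using f f' by (intro exI[of _ "FNeg (FConj (FNeg f) (FNeg f'))"]) auto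
  qed
  then obtain f where f: "is_fm K n f" "pred_free f" "\<forall>e. sat {} e f = P (s e)" by blast
  have "s x = x" if "x \<in> Rn n" for x using that by (auto simp: s_def topspace_Euclidean_space)
  then have "{x \<in> Rn n. P x} = {x \<in> Rn n. sat {} x f}" using f(3) by auto
  then show ?thesis unfolding definable_RK_def using f by blast
qed

text \<open>The bound variables are chosen beyond the first \<open>n\<close> and numbered by a
  bijection \<open>h\<close> from \<open>{..<m}\<close>, so that they can be listed in front of the
  point in one tuple.\<close>

lemma special_projection:
  assumes "special S"
  shows "\<exists>m D. definable_RK K (m + n) D \<and>
    {x \<in> Rn n. S x} = (\<Union>q\<in>Qn m. {a \<in> Rn n. tuple_append m q a \<in> D})"
proof -
  obtain J E G where J: "finite J" "asys E" "asys G" "J \<inter> {..<n} = {}" "S = qex J (basic E G)"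
    using special_fresh[OF assms, of "{..<n}"] by (metis finite_lessThan)
  define m where "m = card J"
  obtain h where h: "bij_betw h {..<m} J"
    using ex_bij_betw_nat_finite[OF J(1)] unfolding m_def atLeast0LessThan by blast
  define p where "p = inv_into {..<m} h"
  have p: "p i < m" "h (p i) = i" if "i \<in> J" for i
    using that h bij_betw_inv_into[OF h] bij_betw_inv_into_right[OF h] unfolding p_def
    by (auto simp: bij_betw_def)
  have hJ: "h i \<in> J" if "i < m" for i using h that by (auto simp: bij_betw_def)
  \<comment> \<open>The first \<open>m\<close> entries of a tuple are handed to the bound variables,
    the next \<open>n\<close> to the point.\<close>
  define s where "s e i = (if i \<in> J then e (p i) else if i < n then e (m + i) else 0 :: real)" for e i
  have "\<exists>t. is_tm K (m + n) t \<and> (\<forall>e. tm_val e t = s e i)" for i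
  proof -
    have "is_tm K (m + n) (Var (p i))" if "i \<in> J" using p(1)[OF that] by simp
    moreover have "is_tm K (m + n) (Var (m + i))" if "i < n" using that by simp
    ultimately show ?thesis unfolding s_def
      by (intro exI[of _ "if i \<in> J then Var (p i) else if i < n then Var (m + i) else Param 0"]) auto
  qed
  from basic_formula[of "m + n" s, OF this J(2,3)] obtain f where
    f: "is_fm K (m + n) f" "pred_free f" "\<And>e. sat {} e f = basic E G (s e)" by blast
  define D where "D = {x \<in> Rn (m + n). sat {} x f}"
  have app: "tuple_append m q a \<in> Rn (m + n)" if "a \<in> Rn n" for q a
    using that by (auto simp: topspace_Euclidean_space tuple_append_def)
  have sapp: "s (tuple_append m q a) i = (if i \<in> J then q (p i) else a i)" if "a \<in> Rn n" for q a i
    using that p(1) by (auto simp: s_def tuple_append_def topspace_Euclidean_space)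
  have "{x \<in> Rn n. S x} = (\<Union>q\<in>Qn m. {a \<in> Rn n. tuple_append m q a \<in> D})"
  proof (intro equalityI subsetI)
    fix a assume "a \<in> {x \<in> Rn n. S x}"
    then have a: "a \<in> Rn n" "qex J (basic E G) a" unfolding J(5) by auto
    from a(2) obtain e where e: "\<And>i. i \<notin> J \<Longrightarrow> e i = a i" "\<And>i. i \<in> J \<Longrightarrow> e i \<in> \<rat>" "basic E G e"
      by (elim qexE) blast
    define q where "q i = (if i < m then e (h i) else 0)" for i
    have "q \<in> Qn m" using e(2) hJ by (auto simp: Qn_def q_def topspace_Euclidean_space)
    moreover have "s (tuple_append m q a) = e" using sapp[OF a(1)] p e(1) by (auto simp: q_def)
    then have "tuple_append m q a \<in> D" using app[OF a(1)] f(3) e(3) by (simp add: D_def)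
    ultimately show "a \<in> (\<Union>q\<in>Qn m. {a \<in> Rn n. tuple_append m q a \<in> D})" using a(1) by blast
  next
    fix a assume "a \<in> (\<Union>q\<in>Qn m. {a \<in> Rn n. tuple_append m q a \<in> D})"
    then obtain q where q: "q \<in> Qn m" "a \<in> Rn n" "tuple_append m q a \<in> D" by blast
    have "basic E G (s (tuple_append m q a))" using q(3) f(3) by (simp add: D_def)
    then have "qex J (basic E G) a"
      by (rule qexI[rotated 2]) (use sapp[OF q(2)] q(1) p(1) in \<open>auto simp: Qn_def\<close>)
    then show "a \<in> {x \<in> Rn n. S x}" using q(2) by (simp add: J(5))
  qed
  moreover have "definable_RK K (m + n) D" unfolding definable_RK_def D_def using f(1,2) by blast
  ultimately show ?thesis by blast
qed

lemma nf_boolean_combination: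
  assumes "nf P"
  shows "{x \<in> Rn n. P x} \<in> boolean_combinations (Rn n)
    {(\<Union>q\<in>Qn m. {a \<in> Rn n. tuple_append m q a \<in> D}) | m D. definable_RK K (m + n) D}" (is "_ \<in> ?B")
  using assms
proof (induction rule: funion.induct)
  have special: "{x \<in> Rn n. S x} \<in> ?B" if "special S" for S
    by (rule boolean_combinations.base) (use special_projection[OF that, of n] in blast)
  {
    case funion_empty
    \<comment> \<open>The empty set is a generator too, given by the inequality 0 < 0.\<close>
    have "special (basic {} {\<lambda>_. 0})" by (intro special_basic asys_empty asys_insert aff_const)
    from special[OF this] show ?case by (simp add: basic_def)
  next
    case (funion_insert p q)
    obtain S T where S: "special S" and T: "finite T" "\<And>F. F \<in> T \<Longrightarrow> equational F"
      and p: "p = (\<lambda>e. S e \<and> (\<forall>F\<in>T. \<not> F e))"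
      using funion_insert.hyps(1) unfolding piece_def by blast
    have "{x \<in> Rn n. S x \<and> (\<forall>F\<in>T. \<not> F x)} \<in> ?B"
      using T
    proof (induction T rule: finite_induct)
      case empty
      show ?case using special[OF S] by simp
    next
      case (insert F T)
      have "{x \<in> Rn n. S x \<and> (\<forall>F\<in>insert F T. \<not> F x)} =
        {x \<in> Rn n. S x \<and> (\<forall>F\<in>T. \<not> F x)} \<inter> (Rn n - {x \<in> Rn n. F x})" by auto
      moreover have "{x \<in> Rn n. S x \<and> (\<forall>F\<in>T. \<not> F x)} \<in> ?B"
        by (rule insert.IH, rule insert.prems) simp
      moreover have "{x \<in> Rn n. F x} \<in> ?B"
        by (rule special[OF equational_special], rule insert.prems) simp
      ultimately show ?case by (simp only: boolean_combinations.inter boolean_combinations.compl)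
    qed
    moreover have "{x \<in> Rn n. p x \<or> q x} = {x \<in> Rn n. p x} \<union> {x \<in> Rn n. q x}" by auto
    ultimately show ?case using funion_insert.IH unfolding p by (simp only: boolean_combinations.union)
  }
qed

text \<open>An open set is the complement of the closure of its complement. That closure is
  semilinear by \<open>nf_limit\<close>, hence so is the set.\<close>

lemma open_definable:
  assumes "openin (Euclidean_space n) U" "definable_pair K \<rat> n U"
  shows "definable_RK K n U"
proof -
  obtain f where f: "is_fm K n f" "U = {x \<in> Rn n. sat \<rat> x f}"
    using assms(2) unfolding definable_pair_def by blast
  let ?L = "limit n (\<lambda>e. \<not> sat \<rat> e f)"
  have "semilin (\<lambda>e. \<not> ?L e)" by (intro semilin_not nf_limit nf_not sat_nf[OF f(1)])
  moreover have "U = {x \<in> Rn n. \<not> ?L x}"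
  proof (intro equalityI subsetI)
    fix a assume a: "a \<in> U"
    then obtain \<epsilon> where "\<epsilon> > 0" "\<forall>e\<in>Rn n. (\<forall>i<n. \<bar>e i - a i\<bar> < \<epsilon>) \<longrightarrow> e \<in> U"
      using openin_Euclidean_space_box[OF assms(1)] by blast
    then have "\<not> ?L a" unfolding limit_def f(2) by (auto simp: topspace_Euclidean_space)
    then show "a \<in> {x \<in> Rn n. \<not> ?L x}" using a f(2) by simp
  next
    fix a assume a: "a \<in> {x \<in> Rn n. \<not> ?L x}"
    then have "sat \<rat> a f" unfolding limit_def by (auto simp: topspace_Euclidean_space)
    then show "a \<in> U" using a f(2) by simp
  qed
  ultimately show ?thesis using semilin_definable by simp
qed

end

section \<open>Translation from algebraic subfields, and the theorem\<close>

lemma subfield_imp_real_subfield: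
  assumes "subfield K (ring_of_type_algebra :: real ring)"
  shows "real_subfield K"
proof -
  let ?R = "ring_of_type_algebra :: real ring"
  have field: "field ?R" by (rule field_from_type_algebra)
  interpret field ?R by (rule field)
  note sub = subringE[OF subfieldE(1)[OF assms]]
  have ops: "\<zero>\<^bsub>?R\<^esub> = 0" "\<one>\<^bsub>?R\<^esub> = 1" "\<And>x y. x \<oplus>\<^bsub>?R\<^esub> y = x + y" "\<And>x y. x \<otimes>\<^bsub>?R\<^esub> y = x * y"
    "carrier ?R = UNIV" by (auto simp: ring_of_type_algebra_def)
  have neg: "\<ominus>\<^bsub>?R\<^esub> x = - x" for x
    using r_neg[of x] by (simp add: ops)
  show ?thesis
  proof
    show "a + b \<in> K" if "a \<in> K" "b \<in> K" for a b using sub(7)[OF that] by (simp add: ops)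
    show "a * b \<in> K" if "a \<in> K" "b \<in> K" for a b using sub(6)[OF that] by (simp add: ops)
    show "- a \<in> K" if "a \<in> K" for a using sub(5)[OF that] by (simp add: neg)
    show "1 \<in> K" using sub(3) by (simp add: ops)
    show "inverse a \<in> K" if "a \<in> K" for a
    proof (cases "a = 0")
      case False
      have "inv\<^bsub>?R\<^esub> a \<in> K" "a * inv\<^bsub>?R\<^esub> a = 1"
        using subfield_m_inv(1,2)[OF assms, of a] that False by (auto simp: ops)
      then show ?thesis by (metis inverse_unique)
    qed (use that in simp)
  qed
qed

theorem theoremA:
  fixes K :: "real set" and n :: nat
  assumes "subfield K (ring_of_type_algebra :: real ring)"
  shows "(\<forall>S. definable_pair K \<rat> n S \<longrightarrow>
            S \<in> boolean_combinations (Rn n)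
                  {(\<Union>q\<in>Qn m. {a \<in> Rn n. tuple_append m q a \<in> D}) | m D.
                     definable_RK K (m + n) D})
         \<and> (\<forall>U. openin (Euclidean_space n) U \<and> definable_pair K \<rat> n U \<longrightarrow> definable_RK K n U)"
proof -
  interpret real_subfield K by (rule subfield_imp_real_subfield[OF assms])
  show ?thesis
  proof (intro conjI allI impI)
    fix S assume "definable_pair K \<rat> n S"
    then obtain f where "is_fm K n f" "S = {x \<in> Rn n. sat \<rat> x f}" unfolding definable_pair_def by blast
    then show "S \<in> boolean_combinations (Rn n)
      {(\<Union>q\<in>Qn m. {a \<in> Rn n. tuple_append m q a \<in> D}) | m D. definable_RK K (m + n) D}"
      using nf_boolean_combination[OF sat_nf] by simp
  qed (use open_definable in blast)
qed

end
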